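(* Let $\Theta$ be a variety of many-sorted algebras such that $\Phi(F(x^{(i)}))\cong F(x^{(i)})$ for every automorphism $\Phi$ of the category $\Theta^0$, every sort $i\in\Gamma$ and every $x^{(i)}\in X_0^{(i)}$. Let $\mathfrak{A}$ be the group of all automorphisms of the category $\Theta^0$, $\mathfrak{Y}$ the group of all inner automorphisms of $\Theta^0$, and $\mathfrak{S}$ the group of all strongly stable automorphisms of $\Theta^0$. Then $\mathfrak{A}=\mathfrak{Y}\mathfrak{S}=\mathfrak{S}\mathfrak{Y}$.
   Context: Many-sorted algebras. Fix a finite set $\Gamma$ of names of sorts and a signature $\Omega$; each $\omega\in\Omega$ has a type $\tau_\omega=(i_1,\ldots,i_n;j)$ with $n\in\mathbb{N}$ ($n=0$ allowed: a constant of sort $j$) and $i_1,\ldots,i_n,j\in\Gamma$. An algebra is a set $A$ with a map $\eta_A:A\to\Gamma$ and, for each $\omega\in\Omega$ of type $(i_1,\ldots,i_n;j)$, an operation $A^{(i_1)}\times\cdots\times A^{(i_n)}\to A^{(j)}$, where $A^{(i)}=\eta_A^{-1}(i)$. The sets $A^{(i)}$ may be empty; $\Gamma_A=\mathrm{im}\,\eta_A$. A homomorphism $\varphi:A\to B$ is a map with $\eta_A=\eta_B\varphi$ commuting with all operations. An identity $w_1=w_2$ is a pair of terms of the same sort over a $\Gamma$-sorted alphabet; if $X'$ is the finite set of letters occurring in $w_1$ or $w_2$, the identity holds in $A$ if $\varphi(w_1)=\varphi(w_2)$ for every homomorphism $\varphi$ from the term algebra over $X'$ to $A$. A variety $\Theta$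 is the class of all algebras satisfying a given set of identities. An algebra $F=F(X)\in\Theta$ is free with set of free generators $X\subset F$ if for every $A\in\Theta$ with $\Gamma_A\supseteq\eta_F(X)$ every sort-preserving map $X\to A$ extends to a unique homomorphism $F\to A$. The category $\Theta^0$. Let $X_0$ be a $\Gamma$-sorted set such that the set $X_0^{(i)}$ of its elements of sort $i$ is countably infinite for every $i\in\Gamma$. The objects of $\Theta^0$ are the free algebras $F(X)$ of $\Theta$ with $X\subset X_0$ finite; the morphisms are all homomorphisms between them. $F(x^{(i)})$ is the free algebra on the single generator $x^{(i)}$. An automorphism $\Upsilon$ of a category $\mathfrak{K}$ is inner if it is isomorphic, as a functor, to the identity automorphism of $\mathfrak{K}$; that is, there are isomorphisms $s_A^{\Upsilon}:A\to\Upsilon(A)$ ($A\in\mathrm{Ob}\,\mathfrak{K}$) such that $\Upsilon(\mu)s_A^{\Upsilon}=s_B^{\Upsilon}\mu$ for every morphism $\mu:A\to B$. An automorphism $\Phi$ of $\Theta^0$ is strongly stable if $\Phi$ preserves all objects of $\Theta^0$ and there is a system of bijections $\{s_F:F\to F\mid F\in\mathrm{Ob}\,\Theta^0\}$ with $\eta_F=\eta_Fs_F$ for every $F$, with $\Phi(\mu)=s_B\mu s_A^{-1}$ for every morphism $\mu:A\to B$ of $\Theta^0$, and with $s_F|_X=\mathrm{id}_X$ for every $F=F(X)\in\mathrm{Ob}\,\Theta^0$. *)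

theory Defs
  imports "HOL-Algebra.Coset" "HOL-Algebra.Bij" "HOL-Library.Countable_Set"
begin

section \<open>Many-sorted algebras\<close>

record ('s, 'f) signature =
  Sorts :: "'s set"
  Ops :: "'f set"
  arity :: "'f \<Rightarrow> 's list \<times> 's"

definition signature :: "('s, 'f) signature \<Rightarrow> bool" where
  "signature S \<longleftrightarrow> finite (Sorts S) \<and>
     (\<forall>f\<in>Ops S. set (fst (arity S f)) \<subseteq> Sorts S \<and> snd (arity S f) \<in> Sorts S)"

record ('s, 'f, 'a) algebra =
  univ :: "'a set"
  sort_of :: "'a \<Rightarrow> 's"
  oper :: "'f \<Rightarrow> 'a list \<Rightarrow> 'a"

definition args :: "('s, 'f) signature \<Rightarrow> ('s, 'f, 'a) algebra \<Rightarrow> 'f \<Rightarrow> 'a list set" where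
  "args S A f = {as. set as \<subseteq> univ A \<and> map (sort_of A) as = fst (arity S f)}"

definition is_algebra :: "('s, 'f) signature \<Rightarrow> ('s, 'f, 'a) algebra \<Rightarrow> bool" where
  "is_algebra S A \<longleftrightarrow> sort_of A ` univ A \<subseteq> Sorts S \<and>
     (\<forall>f\<in>Ops S. \<forall>as\<in>args S A f.
        oper A f as \<in> univ A \<and> sort_of A (oper A f as) = snd (arity S f))"

definition homs ::
  "('s, 'f) signature \<Rightarrow> ('s, 'f, 'a) algebra \<Rightarrow> ('s, 'f, 'b) algebra \<Rightarrow> ('a \<Rightarrow> 'b) set" where
  "homs S A B = {\<phi> \<in> univ A \<rightarrow>\<^sub>E univ B.
     (\<forall>a\<in>univ A. sort_of A a = sort_of B (\<phi> a)) \<and>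
     (\<forall>f\<in>Ops S. \<forall>as\<in>args S A f. \<phi> (oper A f as) = oper B f (map \<phi> as))}"


section \<open>Terms, identities, varieties\<close>

datatype (letters: 'x, 'f) trm = Var 'x | App 'f "('x, 'f) trm list"

fun trm_sort :: "('s, 'f) signature \<Rightarrow> ('x \<Rightarrow> 's) \<Rightarrow> ('x, 'f) trm \<Rightarrow> 's" where
  "trm_sort S \<eta> (Var x) = \<eta> x"
| "trm_sort S \<eta> (App f ts) = snd (arity S f)"

text \<open>A sorted alphabet is a set \<open>X\<close> of letters together with a sort map \<open>\<eta>\<close>.\<close>

inductive_set trms :: "('s, 'f) signature \<Rightarrow> ('x \<Rightarrow> 's) \<Rightarrow> 'x set \<Rightarrow> ('x, 'f) trm set"
  for S \<eta> X where
  Var: "x \<in> X \<Longrightarrow> Var x \<in> trms S \<eta> X"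
| App: "\<lbrakk>f \<in> Ops S; \<forall>t\<in>set ts. t \<in> trms S \<eta> X; map (trm_sort S \<eta>) ts = fst (arity S f)\<rbrakk>
    \<Longrightarrow> App f ts \<in> trms S \<eta> X"

definition trm_algebra ::
  "('s, 'f) signature \<Rightarrow> ('x \<Rightarrow> 's) \<Rightarrow> 'x set \<Rightarrow> ('s, 'f, ('x, 'f) trm) algebra" where
  "trm_algebra S \<eta> X = \<lparr>univ = trms S \<eta> X, sort_of = trm_sort S \<eta>, oper = App\<rparr>"

definition is_identity ::
  "('s, 'f) signature \<Rightarrow> ('v \<Rightarrow> 's) \<Rightarrow> ('v, 'f) trm \<times> ('v, 'f) trm \<Rightarrow> bool" where
  "is_identity S \<eta> = (\<lambda>(w1, w2). let X' = letters w1 \<union> letters w2 in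
     \<eta> ` X' \<subseteq> Sorts S \<and> w1 \<in> trms S \<eta> X' \<and> w2 \<in> trms S \<eta> X' \<and>
     trm_sort S \<eta> w1 = trm_sort S \<eta> w2)"

definition satisfies ::
  "('s, 'f) signature \<Rightarrow> ('v \<Rightarrow> 's) \<Rightarrow> ('s, 'f, 'a) algebra
     \<Rightarrow> ('v, 'f) trm \<times> ('v, 'f) trm \<Rightarrow> bool" where
  "satisfies S \<eta> A = (\<lambda>(w1, w2).
     \<forall>\<phi>\<in>homs S (trm_algebra S \<eta> (letters w1 \<union> letters w2)) A. \<phi> w1 = \<phi> w2)"

definition variety ::
  "('s, 'f) signature \<Rightarrow> ('v \<Rightarrow> 's) \<Rightarrow> (('v, 'f) trm \<times> ('v, 'f) trm) set
     \<Rightarrow> ('s, 'f, 'a) algebra set" where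
  "variety S \<eta> E = {A. is_algebra S A \<and> (\<forall>e\<in>E. satisfies S \<eta> A e)}"


section \<open>Free algebras\<close>

definition free_generators ::
  "('s, 'f) signature \<Rightarrow> ('s, 'f, 'b) algebra set \<Rightarrow> ('s, 'f, 'a) algebra \<Rightarrow> 'a set \<Rightarrow> bool" where
  "free_generators S \<Theta> F Y \<longleftrightarrow> Y \<subseteq> univ F \<and>
     (\<forall>A\<in>\<Theta>. sort_of F ` Y \<subseteq> sort_of A ` univ A \<longrightarrow>
       (\<forall>g\<in>Y \<rightarrow> univ A. (\<forall>y\<in>Y. sort_of F y = sort_of A (g y)) \<longrightarrow>
         (\<exists>!h. h \<in> homs S F A \<and> (\<forall>y\<in>Y. h y = g y))))"

text \<open>The congruence on the term algebra over \<open>X\<close> (sorted by \<open>\<xi>\<close>) generated by all instances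
  of the identities \<open>E\<close>, whose letters are sorted by \<open>\<eta>\<close>. Substitutions are the homomorphisms
  between term algebras.\<close>

inductive_set consequences ::
  "('s, 'f) signature \<Rightarrow> ('v \<Rightarrow> 's) \<Rightarrow> (('v, 'f) trm \<times> ('v, 'f) trm) set
     \<Rightarrow> ('x \<Rightarrow> 's) \<Rightarrow> 'x set \<Rightarrow> (('x, 'f) trm \<times> ('x, 'f) trm) set"
  for S \<eta> E \<xi> X where
  inst: "\<lbrakk>(w1, w2) \<in> E;
      \<theta> \<in> homs S (trm_algebra S \<eta> (letters w1 \<union> letters w2)) (trm_algebra S \<xi> X)\<rbrakk>
    \<Longrightarrow> (\<theta> w1, \<theta> w2) \<in> consequences S \<eta> E \<xi> X"
| refl: "t \<in> trms S \<xi> X \<Longrightarrow> (t, t) \<in> consequences S \<eta> E \<xi> X"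
| sym: "(t, u) \<in> consequences S \<eta> E \<xi> X \<Longrightarrow> (u, t) \<in> consequences S \<eta> E \<xi> X"
| trans: "\<lbrakk>(t, u) \<in> consequences S \<eta> E \<xi> X; (u, v) \<in> consequences S \<eta> E \<xi> X\<rbrakk>
    \<Longrightarrow> (t, v) \<in> consequences S \<eta> E \<xi> X"
| cong: "\<lbrakk>f \<in> Ops S; map (trm_sort S \<xi>) ts = fst (arity S f);
      list_all2 (\<lambda>t u. (t, u) \<in> consequences S \<eta> E \<xi> X) ts us\<rbrakk>
    \<Longrightarrow> (App f ts, App f us) \<in> consequences S \<eta> E \<xi> X"

definition gen ::
  "('s, 'f) signature \<Rightarrow> ('v \<Rightarrow> 's) \<Rightarrow> (('v, 'f) trm \<times> ('v, 'f) trm) set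
     \<Rightarrow> ('x \<Rightarrow> 's) \<Rightarrow> 'x set \<Rightarrow> 'x \<Rightarrow> ('x, 'f) trm set" where
  "gen S \<eta> E \<xi> X x = consequences S \<eta> E \<xi> X `` {Var x}"

text \<open>The standard model of \<open>F(X)\<close>: the quotient of the term algebra. A letter \<open>x \<in> X\<close> is
  identified with the element \<open>gen S \<eta> E \<xi> X x\<close>.\<close>

definition free_algebra ::
  "('s, 'f) signature \<Rightarrow> ('v \<Rightarrow> 's) \<Rightarrow> (('v, 'f) trm \<times> ('v, 'f) trm) set
     \<Rightarrow> ('x \<Rightarrow> 's) \<Rightarrow> 'x set \<Rightarrow> ('s, 'f, ('x, 'f) trm set) algebra" where
  "free_algebra S \<eta> E \<xi> X =
    \<lparr>univ = trms S \<xi> X // consequences S \<eta> E \<xi> X,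
     sort_of = (\<lambda>c. trm_sort S \<xi> (SOME t. t \<in> c)),
     oper = (\<lambda>f cs. consequences S \<eta> E \<xi> X `` {App f (map (\<lambda>c. SOME t. t \<in> c) cs)})\<rparr>"


section \<open>Automorphisms of categories\<close>

text \<open>\<open>Comp C g f\<close> is the composite ``first \<open>f\<close>, then \<open>g\<close>''.\<close>

record ('o, 'm) category =
  Obj :: "'o set"
  Mor :: "'m set"
  Dom :: "'m \<Rightarrow> 'o"
  Cod :: "'m \<Rightarrow> 'o"
  Ident :: "'o \<Rightarrow> 'm"
  Comp :: "'m \<Rightarrow> 'm \<Rightarrow> 'm"

definition is_category :: "('o, 'm) category \<Rightarrow> bool" where
  "is_category C \<longleftrightarrow>
     Dom C ` Mor C \<subseteq> Obj C \<and> Cod C ` Mor C \<subseteq> Obj C \<and>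
     (\<forall>A\<in>Obj C. Ident C A \<in> Mor C \<and> Dom C (Ident C A) = A \<and> Cod C (Ident C A) = A) \<and>
     (\<forall>f\<in>Mor C. Comp C f (Ident C (Dom C f)) = f \<and> Comp C (Ident C (Cod C f)) f = f) \<and>
     (\<forall>f\<in>Mor C. \<forall>g\<in>Mor C. Cod C f = Dom C g \<longrightarrow>
        Comp C g f \<in> Mor C \<and> Dom C (Comp C g f) = Dom C f \<and> Cod C (Comp C g f) = Cod C g) \<and>
     (\<forall>f\<in>Mor C. \<forall>g\<in>Mor C. \<forall>h\<in>Mor C. Cod C f = Dom C g \<longrightarrow> Cod C g = Dom C h \<longrightarrow>
        Comp C h (Comp C g f) = Comp C (Comp C h g) f)"

definition isos :: "('o, 'm) category \<Rightarrow> 'o \<Rightarrow> 'o \<Rightarrow> 'm set" where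
  "isos C A B = {m \<in> Mor C. Dom C m = A \<and> Cod C m = B \<and>
     (\<exists>n\<in>Mor C. Dom C n = B \<and> Cod C n = A \<and> Comp C n m = Ident C A \<and> Comp C m n = Ident C B)}"

definition isomorphic :: "('o, 'm) category \<Rightarrow> 'o \<Rightarrow> 'o \<Rightarrow> bool" where
  "isomorphic C A B \<longleftrightarrow> isos C A B \<noteq> {}"

text \<open>An automorphism is a pair (object part, morphism part). Both parts are
  extensional (see \<^const>\<open>Bij\<close>), so that equality of pairs is equality of functors.\<close>

definition automorphisms :: "('o, 'm) category \<Rightarrow> (('o \<Rightarrow> 'o) \<times> ('m \<Rightarrow> 'm)) set" where
  "automorphisms C = {(Fo, Fm).
     Fo \<in> Bij (Obj C) \<and> Fm \<in> Bij (Mor C) \<and>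
     (\<forall>f\<in>Mor C. Dom C (Fm f) = Fo (Dom C f) \<and> Cod C (Fm f) = Fo (Cod C f)) \<and>
     (\<forall>A\<in>Obj C. Fm (Ident C A) = Ident C (Fo A)) \<and>
     (\<forall>f\<in>Mor C. \<forall>g\<in>Mor C. Cod C f = Dom C g \<longrightarrow> Fm (Comp C g f) = Comp C (Fm g) (Fm f))}"

definition aut_group :: "('o, 'm) category \<Rightarrow> (('o \<Rightarrow> 'o) \<times> ('m \<Rightarrow> 'm)) monoid" where
  "aut_group C =
    \<lparr>carrier = automorphisms C,
     mult = (\<lambda>(Fo, Fm) (Go, Gm). (compose (Obj C) Fo Go, compose (Mor C) Fm Gm)),
     one = (\<lambda>A\<in>Obj C. A, \<lambda>f\<in>Mor C. f)\<rparr>"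

definition inner_automorphisms :: "('o, 'm) category \<Rightarrow> (('o \<Rightarrow> 'o) \<times> ('m \<Rightarrow> 'm)) set" where
  "inner_automorphisms C = {(Fo, Fm) \<in> automorphisms C.
     \<exists>s. (\<forall>A\<in>Obj C. s A \<in> isos C A (Fo A)) \<and>
         (\<forall>f\<in>Mor C. Comp C (Fm f) (s (Dom C f)) = Comp C (s (Cod C f)) f)}"


section \<open>The category of finitely generated free algebras of a variety\<close>

text \<open>The object \<open>F(X)\<close> is represented by \<open>X\<close>, and a morphism by its triple (domain, map,
  codomain). The generators of \<open>F(X)\<close> are the letters themselves, i.e. \<open>X \<subseteq> F(X)\<close>, so
  \<^const>\<open>gen\<close> must be injective on \<open>X\<close>. It fails to be only if the identities force two
  letters of \<open>X\<close> to be equal, and then the variety has no free algebra with set of free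
  generators \<open>X\<close>; see \<open>inj_on_gen\<close> below.\<close>

definition free_objects ::
  "('s, 'f) signature \<Rightarrow> ('v \<Rightarrow> 's) \<Rightarrow> (('v, 'f) trm \<times> ('v, 'f) trm) set
     \<Rightarrow> ('x \<Rightarrow> 's) \<Rightarrow> 'x set \<Rightarrow> 'x set set" where
  "free_objects S \<eta> E \<xi> X0 = {X. finite X \<and> X \<subseteq> X0 \<and> inj_on (gen S \<eta> E \<xi> X) X \<and>
     free_algebra S \<eta> E \<xi> X \<in> variety S \<eta> E \<and>
     free_generators S (variety S \<eta> E :: ('s, 'f, ('x, 'f) trm set) algebra set)
       (free_algebra S \<eta> E \<xi> X) (gen S \<eta> E \<xi> X ` X)}"

definition free_category ::
  "('s, 'f) signature \<Rightarrow> ('v \<Rightarrow> 's) \<Rightarrow> (('v, 'f) trm \<times> ('v, 'f) trm) set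
     \<Rightarrow> ('x \<Rightarrow> 's) \<Rightarrow> 'x set
     \<Rightarrow> ('x set, 'x set \<times> (('x, 'f) trm set \<Rightarrow> ('x, 'f) trm set) \<times> 'x set) category" where
  "free_category S \<eta> E \<xi> X0 = (let F = free_algebra S \<eta> E \<xi> in
    \<lparr>Obj = free_objects S \<eta> E \<xi> X0,
     Mor = {(X, \<mu>, Y). X \<in> free_objects S \<eta> E \<xi> X0 \<and> Y \<in> free_objects S \<eta> E \<xi> X0 \<and>
              \<mu> \<in> homs S (F X) (F Y)},
     Dom = (\<lambda>(X, \<mu>, Y). X),
     Cod = (\<lambda>(X, \<mu>, Y). Y),
     Ident = (\<lambda>X. (X, \<lambda>a\<in>univ (F X). a, X)),
     Comp = (\<lambda>(Y, \<nu>, Z) (X, \<mu>, Y'). (X, compose (univ (F X)) \<nu> \<mu>, Z))\<rparr>)"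

definition strongly_stable_automorphisms ::
  "('s, 'f) signature \<Rightarrow> ('v \<Rightarrow> 's) \<Rightarrow> (('v, 'f) trm \<times> ('v, 'f) trm) set
     \<Rightarrow> ('x \<Rightarrow> 's) \<Rightarrow> 'x set
     \<Rightarrow> (('x set \<Rightarrow> 'x set) \<times>
         ('x set \<times> (('x, 'f) trm set \<Rightarrow> ('x, 'f) trm set) \<times> 'x set
            \<Rightarrow> 'x set \<times> (('x, 'f) trm set \<Rightarrow> ('x, 'f) trm set) \<times> 'x set)) set" where
  "strongly_stable_automorphisms S \<eta> E \<xi> X0 =
    (let F = free_algebra S \<eta> E \<xi>; C = free_category S \<eta> E \<xi> X0 in
    {(\<Phi>o, \<Phi>m) \<in> automorphisms C.
       (\<forall>X\<in>Obj C. \<Phi>o X = X) \<and>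
       (\<exists>s. (\<forall>X\<in>Obj C. bij_betw (s X) (univ (F X)) (univ (F X)) \<and>
                (\<forall>a\<in>univ (F X). sort_of (F X) a = sort_of (F X) (s X a)) \<and>
                (\<forall>x\<in>X. s X (gen S \<eta> E \<xi> X x) = gen S \<eta> E \<xi> X x)) \<and>
            (\<forall>X \<mu> Y. (X, \<mu>, Y) \<in> Mor C \<longrightarrow>
                \<Phi>m (X, \<mu>, Y) =
                  (X, \<lambda>a\<in>univ (F X). s Y (\<mu> (inv_into (univ (F X)) (s X) a)), Y)))})"


section \<open>Adequacy of the definitions\<close>

primrec trm_eval :: "('s, 'f, 'b) algebra \<Rightarrow> ('y \<Rightarrow> 'b) \<Rightarrow> ('y, 'f) trm \<Rightarrow> 'b" where
  "trm_eval A h (Var x) = h x"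
| "trm_eval A h (App f ts) = oper A f (map (trm_eval A h) ts)"

lemma trm_eval:
  assumes "is_algebra S A" "\<forall>y\<in>Y. h y \<in> univ A \<and> sort_of A (h y) = \<zeta> y" "t \<in> trms S \<zeta> Y"
  shows "trm_eval A h t \<in> univ A \<and> sort_of A (trm_eval A h t) = trm_sort S \<zeta> t"
  using assms(3)
proof induction
  case (Var x) then show ?case using assms(2) by auto
next
  case (App f ts)
  have "map (trm_eval A h) ts \<in> args S A f"
    using App unfolding args_def by (auto simp flip: App.hyps(2))
  then show ?case using assms(1) App.hyps(1) unfolding is_algebra_def by auto
qed

lemma trm_eval_hom:
  assumes "is_algebra S A" "\<forall>y\<in>Y. h y \<in> univ A \<and> sort_of A (h y) = \<zeta> y"
  shows "restrict (trm_eval A h) (trms S \<zeta> Y) \<in> homs S (trm_algebra S \<zeta> Y) A"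
proof -
  have "App f ts \<in> trms S \<zeta> Y" if "f \<in> Ops S" "ts \<in> args S (trm_algebra S \<zeta> Y) f" for f ts
    using that by (auto simp: args_def trm_algebra_def intro!: trms.App)
  moreover have "map (restrict (trm_eval A h) (trms S \<zeta> Y)) ts = map (trm_eval A h) ts"
    if "ts \<in> args S (trm_algebra S \<zeta> Y) f" for f ts
    using that by (auto simp: args_def trm_algebra_def)
  ultimately show ?thesis
    using trm_eval[OF assms] by (auto simp: homs_def trm_algebra_def simp del: map_eq_conv)
qed

lemma hom_eq_trm_eval:
  assumes "\<phi> \<in> homs S (trm_algebra S \<zeta> Y) A" "t \<in> trms S \<zeta> Y"
  shows "\<phi> t = trm_eval A (\<lambda>y. \<phi> (Var y)) t"
  using assms(2)
proof induction
  case (App f ts)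
  have "ts \<in> args S (trm_algebra S \<zeta> Y) f"
    using App by (auto simp: args_def trm_algebra_def)
  then have "\<phi> (App f ts) = oper A f (map \<phi> ts)"
    using assms(1) App.hyps unfolding homs_def trm_algebra_def by auto
  moreover have "map \<phi> ts = map (trm_eval A (\<lambda>y. \<phi> (Var y))) ts" using App by auto
  ultimately show ?case by simp
qed simp

lemma homs_compose:
  assumes A: "is_algebra S A" and \<phi>: "\<phi> \<in> homs S A B" and \<psi>: "\<psi> \<in> homs S B C"
  shows "compose (univ A) \<psi> \<phi> \<in> homs S A C"
proof -
  have p: "\<phi> a \<in> univ B" "sort_of A a = sort_of B (\<phi> a)" if "a \<in> univ A" for a
    using \<phi> that by (auto simp: homs_def)
  have q: "\<psi> b \<in> univ C" "sort_of B b = sort_of C (\<psi> b)" if "b \<in> univ B" for b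
    using \<psi> that by (auto simp: homs_def)
  have "compose (univ A) \<psi> \<phi> (oper A f as) = oper C f (map (compose (univ A) \<psi> \<phi>) as)"
    if f: "f \<in> Ops S" and as: "as \<in> args S A f" for f as
  proof -
    have sub: "set as \<subseteq> univ A" and "map (sort_of A) as = fst (arity S f)"
      using as by (auto simp: args_def)
    moreover have "map (sort_of B) (map \<phi> as) = map (sort_of A) as" using sub p by auto
    ultimately have b: "map \<phi> as \<in> args S B f" using p by (auto simp: args_def)
    have "oper A f as \<in> univ A" using A f as by (simp add: is_algebra_def)
    then have "compose (univ A) \<psi> \<phi> (oper A f as) = \<psi> (\<phi> (oper A f as))" by (simp add: compose_def)
    also have "\<dots> = \<psi> (oper B f (map \<phi> as))" using \<phi> f as by (simp add: homs_def)
    also have "\<dots> = oper C f (map \<psi> (map \<phi> as))" using \<psi> f b by (simp add: homs_def del: map_map)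
    also have "map \<psi> (map \<phi> as) = map (compose (univ A) \<psi> \<phi>) as"
      using sub by (auto simp: compose_def)
    finally show ?thesis .
  qed
  then show ?thesis using p q by (auto simp: homs_def compose_def)
qed

lemma trm_algebra_is_algebra:
  assumes "signature S" "\<xi> ` X \<subseteq> Sorts S"
  shows "is_algebra S (trm_algebra S \<xi> X)"
proof -
  have "trm_sort S \<xi> t \<in> Sorts S" if "t \<in> trms S \<xi> X" for t
    using that by cases (use assms in \<open>auto simp: signature_def\<close>)
  then show ?thesis by (auto simp: is_algebra_def args_def trm_algebra_def intro!: trms.App)
qed

context
  fixes S :: "('s, 'f) signature"
    and \<eta> :: "'v \<Rightarrow> 's" and E :: "(('v, 'f) trm \<times> ('v, 'f) trm) set"
    and \<xi> :: "'x \<Rightarrow> 's" and X :: "'x set"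
  assumes sig: "signature S" and idn: "\<forall>e\<in>E. is_identity S \<eta> e" and X: "\<xi> ` X \<subseteq> Sorts S"
begin

private abbreviation (input) "T \<equiv> trms S \<xi> X"
private abbreviation (input) "R \<equiv> consequences S \<eta> E \<xi> X"
private abbreviation (input) "F \<equiv> free_algebra S \<eta> E \<xi> X"
private abbreviation (input) "g \<equiv> gen S \<eta> E \<xi> X"
private abbreviation (input) rep :: "('x, 'f) trm set \<Rightarrow> ('x, 'f) trm" where "rep c \<equiv> SOME t. t \<in> c"

private lemma trm_alg: "is_algebra S (trm_algebra S \<xi> X)"
  by (rule trm_algebra_is_algebra[OF sig X])

private lemma consequences_sound:
  assumes "(t, u) \<in> R"
  shows "t \<in> T \<and> u \<in> T \<and> trm_sort S \<xi> t = trm_sort S \<xi> u"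
  using assms
proof induction
  case (inst w1 w2 \<theta>)
  let ?X = "letters w1 \<union> letters w2"
  have w: "w1 \<in> trms S \<eta> ?X" "w2 \<in> trms S \<eta> ?X" "trm_sort S \<eta> w1 = trm_sort S \<eta> w2"
    using bspec[OF idn] inst(1) by (auto simp: is_identity_def Let_def)
  then show ?case using inst(2) by (auto simp: homs_def trm_algebra_def)
next
  case (cong f ts us)
  have l: "length ts = length us" using cong(3) by (simp add: list_all2_lengthD)
  have z: "t \<in> T \<and> u \<in> T \<and> trm_sort S \<xi> t = trm_sort S \<xi> u" if "(t, u) \<in> set (zip ts us)" for t u
    using cong(3) that unfolding list_all2_iff by blast
  have "t \<in> T" if "t \<in> set ts" for t
    using that z l by (metis in_set_impl_in_set_zip1)
  moreover have "u \<in> T" if "u \<in> set us" for u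
    using that z l by (metis in_set_impl_in_set_zip2)
  moreover have "map (trm_sort S \<xi>) us = map (trm_sort S \<xi>) ts"
    using cong(3) by (simp add: list_all2_conv_all_nth list_eq_iff_nth_eq)
  ultimately show ?case using cong(1,2) by (auto intro!: trms.App)
qed auto

private lemma equiv_R: "equiv T R"
proof (rule equivI)
  show "R \<subseteq> T \<times> T" using consequences_sound by auto
  show "refl_on T R" by (auto simp: refl_on_def consequences.refl)
  show "sym R" by (auto simp: sym_def intro: consequences.sym)
  show "trans R" by (rule transI) (rule consequences.trans)
qed

private lemma rep: 
  assumes "c \<in> univ F"
  shows "rep c \<in> c" "rep c \<in> T" "R `` {rep c} = c" "t \<in> c \<Longrightarrow> (t, rep c) \<in> R"
    "sort_of F c = trm_sort S \<xi> (rep c)"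
proof -
  obtain t where t: "t \<in> T" "c = R `` {t}"
    using assms by (auto simp: free_algebra_def quotient_def)
  have "t \<in> c" using t equiv_class_self[OF equiv_R] by auto
  then show 1: "rep c \<in> c" by (rule someI)
  then have 2: "(t, rep c) \<in> R" using t(2) by blast
  show "rep c \<in> T" using consequences_sound[OF 2] by blast
  show 3: "R `` {rep c} = c" unfolding t(2)[symmetric] using equiv_class_eq[OF equiv_R 2] t(2) by metis
  show "t \<in> c \<Longrightarrow> (t, rep c) \<in> R" for t
    using 3 consequences.sym by blast
  show "sort_of F c = trm_sort S \<xi> (rep c)" by (simp add: free_algebra_def)
qed

private lemma cls:
  assumes "t \<in> T"
  shows "R `` {t} \<in> univ F" "(rep (R `` {t}), t) \<in> R" "sort_of F (R `` {t}) = trm_sort S \<xi> t"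
proof -
  show 1: "R `` {t} \<in> univ F" using assms by (auto simp: free_algebra_def quotient_def)
  have "t \<in> R `` {t}" using assms equiv_class_self[OF equiv_R] by auto
  then show 2: "(rep (R `` {t}), t) \<in> R" using rep(1)[OF 1] consequences.sym by auto
  show "sort_of F (R `` {t}) = trm_sort S \<xi> t" using rep(5)[OF 1] consequences_sound[OF 2] by simp
qed

private lemma oper_cls:
  assumes "f \<in> Ops S" "ts \<in> args S (trm_algebra S \<xi> X) f"
  shows "oper F f (map (\<lambda>t. R `` {t}) ts) = R `` {App f ts}"
proof -
  have ts: "set ts \<subseteq> T" "map (trm_sort S \<xi>) ts = fst (arity S f)"
    using assms(2) by (auto simp: args_def trm_algebra_def)
  have "list_all2 (\<lambda>t u. (t, u) \<in> R) ts (map (\<lambda>t. rep (R `` {t})) ts)"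
    unfolding list_all2_conv_all_nth
    using consequences.sym[OF cls(2)[OF subsetD[OF ts(1) nth_mem]]] by simp
  then have "(App f ts, App f (map (\<lambda>t. rep (R `` {t})) ts)) \<in> R"
    using assms(1) ts(2) by (intro consequences.cong)
  then show ?thesis
    using equiv_class_eq[OF equiv_R] by (simp add: free_algebra_def o_def)
qed

private lemma args_rep:
  assumes "cs \<in> args S F f"
  shows "map rep cs \<in> args S (trm_algebra S \<xi> X) f" "cs = map (\<lambda>t. R `` {t}) (map rep cs)"
proof -
  have c: "set cs \<subseteq> univ F" "map (sort_of F) cs = fst (arity S f)"
    using assms by (auto simp: args_def)
  have "map (trm_sort S \<xi>) (map rep cs) = map (sort_of F) cs"
    using c(1) rep(5) by auto
  then show "map rep cs \<in> args S (trm_algebra S \<xi> X) f"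
    using c rep(2) by (auto simp: args_def trm_algebra_def)
  show "cs = map (\<lambda>t. R `` {t}) (map rep cs)"
    using c rep(3) by (auto simp: o_def intro!: map_idI[symmetric])
qed

private lemma App_in: "f \<in> Ops S \<Longrightarrow> ts \<in> args S (trm_algebra S \<xi> X) f \<Longrightarrow> App f ts \<in> T"
  by (auto simp: args_def trm_algebra_def intro!: trms.App)

private lemma alg_F: "is_algebra S F"
  unfolding is_algebra_def
proof (intro conjI ballI)
  show "sort_of F ` univ F \<subseteq> Sorts S"
    using trm_alg rep(2,5) by (force simp: is_algebra_def trm_algebra_def)
next
  fix f cs assume f: "f \<in> Ops S" and cs: "cs \<in> args S F f"
  have eq: "oper F f cs = R `` {App f (map rep cs)}"
    using oper_cls[OF f args_rep(1)[OF cs]] args_rep(2)[OF cs] by simp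
  have a: "App f (map rep cs) \<in> T" using App_in[OF f args_rep(1)[OF cs]] .
  show "oper F f cs \<in> univ F" "sort_of F (oper F f cs) = snd (arity S f)"
    using eq cls[OF a] by auto
qed

private lemma cls_hom: "restrict (\<lambda>t. R `` {t}) T \<in> homs S (trm_algebra S \<xi> X) F"
proof -
  have "oper F f (map (restrict (\<lambda>t. R `` {t}) T) ts) = R `` {App f ts}"
    if "f \<in> Ops S" "ts \<in> args S (trm_algebra S \<xi> X) f" for f ts
  proof -
    have "map (restrict (\<lambda>t. R `` {t}) T) ts = map (\<lambda>t. R `` {t}) ts"
      using that(2) by (auto simp: args_def trm_algebra_def)
    then show ?thesis using oper_cls[OF that] by (simp del: map_eq_conv)
  qed
  then show ?thesis
    using cls App_in by (auto simp: homs_def trm_algebra_def simp del: map_eq_conv)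
qed

lemma free_algebra_in_variety: "free_algebra S \<eta> E \<xi> X \<in> variety S \<eta> E"
proof -
  have "\<phi> w1 = \<phi> w2"
    if e: "(w1, w2) \<in> E" and \<phi>: "\<phi> \<in> homs S (trm_algebra S \<eta> (letters w1 \<union> letters w2)) F"
    for w1 w2 \<phi>
  proof -
    let ?Y = "letters w1 \<union> letters w2"
    have w: "w1 \<in> trms S \<eta> ?Y" "w2 \<in> trms S \<eta> ?Y" "\<eta> ` ?Y \<subseteq> Sorts S"
      using bspec[OF idn e] by (simp_all add: is_identity_def Let_def)
    define k where "k y = rep (\<phi> (Var y))" for y
    have v: "\<phi> (Var y) \<in> univ F" "sort_of F (\<phi> (Var y)) = \<eta> y" if "y \<in> ?Y" for y
      using \<phi> trms.Var[OF that, of S \<eta>] by (auto simp: homs_def trm_algebra_def)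
    have k: "\<forall>y\<in>?Y. k y \<in> univ (trm_algebra S \<xi> X) \<and> sort_of (trm_algebra S \<xi> X) (k y) = \<eta> y"
      using rep v by (auto simp: k_def trm_algebra_def)
    let ?\<theta> = "restrict (trm_eval (trm_algebra S \<xi> X) k) (trms S \<eta> ?Y)"
    have \<theta>: "?\<theta> \<in> homs S (trm_algebra S \<eta> ?Y) (trm_algebra S \<xi> X)"
      by (rule trm_eval_hom[OF trm_alg k])
    define \<psi> where "\<psi> = compose (univ (trm_algebra S \<eta> ?Y)) (restrict (\<lambda>t. R `` {t}) T) ?\<theta>"
    have \<psi>: "\<psi> \<in> homs S (trm_algebra S \<eta> ?Y) F"
      unfolding \<psi>_def by (rule homs_compose[OF trm_algebra_is_algebra[OF sig w(3)] \<theta> cls_hom])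
    have ev: "\<psi> (Var y) = \<phi> (Var y)" if "y \<in> ?Y" for y
      using that k v rep(3) trms.Var[OF that, of S \<eta>]
      by (auto simp: \<psi>_def compose_def k_def trm_algebra_def)
    have ee: "trm_eval F (\<lambda>y. \<psi> (Var y)) t = trm_eval F (\<lambda>y. \<phi> (Var y)) t"
      if "t \<in> trms S \<eta> ?Y" for t
      using that
    proof induction
      case (App f ts)
      then have "map (trm_eval F (\<lambda>y. \<psi> (Var y))) ts = map (trm_eval F (\<lambda>y. \<phi> (Var y))) ts" by auto
      then show ?case by (simp del: map_eq_conv)
    qed (use ev in auto)
    have "\<phi> t = R `` {?\<theta> t}" if "t \<in> trms S \<eta> ?Y" for t
    proof -
      have "?\<theta> t \<in> T" using \<theta> that by (auto simp: homs_def trm_algebra_def)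
      then have "\<psi> t = R `` {?\<theta> t}"
        using that by (auto simp: \<psi>_def compose_def trm_algebra_def)
      then show ?thesis
        using hom_eq_trm_eval[OF \<phi> that] hom_eq_trm_eval[OF \<psi> that] ee[OF that] by simp
    qed
    moreover have "R `` {?\<theta> w1} = R `` {?\<theta> w2}"
      using equiv_class_eq[OF equiv_R] consequences.inst[OF e \<theta>] by blast
    ultimately show ?thesis using w by simp
  qed
  then show ?thesis using alg_F by (auto simp: variety_def satisfies_def)
qed

private lemma eval_respects:
  assumes A: "A \<in> variety S \<eta> E" and h: "\<forall>x\<in>X. h x \<in> univ A \<and> sort_of A (h x) = \<xi> x"
    and "(t, u) \<in> R"
  shows "trm_eval A h t = trm_eval A h u"
  using assms(3)
proof induction
  case (inst w1 w2 \<theta>)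
  let ?Y = "letters w1 \<union> letters w2"
  have alg: "is_algebra S A" using A by (simp add: variety_def)
  have w: "w1 \<in> trms S \<eta> ?Y" "w2 \<in> trms S \<eta> ?Y" "\<eta> ` ?Y \<subseteq> Sorts S"
    using bspec[OF idn inst(1)] by (simp_all add: is_identity_def Let_def)
  have "compose (univ (trm_algebra S \<eta> ?Y)) (restrict (trm_eval A h) T) \<theta> \<in> homs S (trm_algebra S \<eta> ?Y) A"
    by (rule homs_compose[OF trm_algebra_is_algebra[OF sig w(3)] inst(2) trm_eval_hom[OF alg h]])
  moreover have "satisfies S \<eta> A (w1, w2)" using A inst(1) by (auto simp: variety_def)
  ultimately have "compose (univ (trm_algebra S \<eta> ?Y)) (restrict (trm_eval A h) T) \<theta> w1 =
      compose (univ (trm_algebra S \<eta> ?Y)) (restrict (trm_eval A h) T) \<theta> w2"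
    by (auto simp: satisfies_def)
  moreover have "\<theta> w1 \<in> T" "\<theta> w2 \<in> T" using w inst(2) by (auto simp: homs_def trm_algebra_def)
  ultimately show ?case using w by (simp add: compose_def trm_algebra_def)
next
  case (cong f ts us)
  have "map (trm_eval A h) ts = map (trm_eval A h) us"
    using cong(3) by (simp add: list_all2_conv_all_nth list_eq_iff_nth_eq)
  then show ?case by simp
qed auto

lemma free_algebra_universal:
  fixes A :: "('s, 'f, 'b) algebra"
  assumes A: "A \<in> variety S \<eta> E" and h: "\<forall>x\<in>X. h x \<in> univ A \<and> sort_of A (h x) = \<xi> x"
  shows "\<exists>!\<phi>. \<phi> \<in> homs S (free_algebra S \<eta> E \<xi> X) A \<and> (\<forall>x\<in>X. \<phi> (gen S \<eta> E \<xi> X x) = h x)"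
proof -
  have alg: "is_algebra S A" using A by (simp add: variety_def)
  define \<phi> where "\<phi> = restrict (\<lambda>c. trm_eval A h (rep c)) (univ F)"
  have \<phi>c: "\<phi> (R `` {t}) = trm_eval A h t" if "t \<in> T" for t
    using cls[OF that] eval_respects[OF A h] by (auto simp: \<phi>_def)
  have "\<phi> (oper F f cs) = oper A f (map \<phi> cs)" if f: "f \<in> Ops S" and cs: "cs \<in> args S F f" for f cs
  proof -
    have a: "App f (map rep cs) \<in> T" using App_in[OF f args_rep(1)[OF cs]] .
    have "oper F f cs = R `` {App f (map rep cs)}"
      using oper_cls[OF f args_rep(1)[OF cs]] args_rep(2)[OF cs] by simp
    then have "\<phi> (oper F f cs) = trm_eval A h (App f (map rep cs))" using \<phi>c[OF a] by simp
    moreover have "map \<phi> cs = map (\<lambda>c. trm_eval A h (rep c)) cs"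
      using cs by (auto simp: \<phi>_def args_def)
    ultimately show ?thesis by (simp add: o_def del: map_eq_conv)
  qed
  moreover have "\<phi> c \<in> univ A" "sort_of A (\<phi> c) = sort_of F c" if "c \<in> univ F" for c
    using that trm_eval[OF alg h rep(2)[OF that]] rep(5)[OF that] by (auto simp: \<phi>_def)
  ultimately have \<phi>: "\<phi> \<in> homs S F A" by (auto simp: homs_def \<phi>_def)
  have \<phi>g: "\<forall>x\<in>X. \<phi> (g x) = h x" using \<phi>c trms.Var by (fastforce simp: gen_def)
  show ?thesis
  proof (rule ex1I[of _ \<phi>])
    fix \<psi> assume \<psi>: "\<psi> \<in> homs S F A \<and> (\<forall>x\<in>X. \<psi> (g x) = h x)"
    have eq: "\<psi> (R `` {t}) = \<phi> (R `` {t})" if "t \<in> T" for t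
      using that
    proof induction
      case (Var x) then show ?case using \<psi> \<phi>g by (auto simp: gen_def)
    next
      case (App f ts)
      have ts: "ts \<in> args S (trm_algebra S \<xi> X) f" using App by (auto simp: args_def trm_algebra_def)
      have "map (\<lambda>t. R `` {t}) ts \<in> args S F f"
      proof -
        have "map (sort_of F) (map (\<lambda>t. R `` {t}) ts) = map (trm_sort S \<xi>) ts"
          using App.IH cls(3) by simp
        then show ?thesis using App cls(1) by (auto simp: args_def)
      qed
      then have "\<psi> (R `` {App f ts}) = oper A f (map \<psi> (map (\<lambda>t. R `` {t}) ts))"
        "\<phi> (R `` {App f ts}) = oper A f (map \<phi> (map (\<lambda>t. R `` {t}) ts))"
        using \<phi> \<psi> App.hyps(1) unfolding oper_cls[OF App.hyps(1) ts, symmetric]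
        by (simp_all add: homs_def)
      moreover have "map \<psi> (map (\<lambda>t. R `` {t}) ts) = map \<phi> (map (\<lambda>t. R `` {t}) ts)"
        using App.IH by auto
      ultimately show ?case by (simp only:)
    qed
    have "\<psi> c = \<phi> c" if "c \<in> univ F" for c
      using eq[OF rep(2)[OF that]] rep(3)[OF that] by simp
    moreover have "\<psi> \<in> extensional (univ F)" "\<phi> \<in> extensional (univ F)"
      using \<phi> \<psi> by (auto simp: homs_def PiE_def)
    ultimately show "\<psi> = \<phi>" by (rule extensionalityI[rotated 2])
  qed (use \<phi> \<phi>g in auto)
qed

lemma gen_in: "x \<in> X \<Longrightarrow> gen S \<eta> E \<xi> X x \<in> univ (free_algebra S \<eta> E \<xi> X)"
  and sort_gen: "x \<in> X \<Longrightarrow> sort_of (free_algebra S \<eta> E \<xi> X) (gen S \<eta> E \<xi> X x) = \<xi> x"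
  using cls[OF trms.Var] by (auto simp: gen_def)

text \<open>The algebras \<open>A\<close> may have an arbitrary carrier type here.\<close>

lemma free_generators_free_algebra:
  "free_generators S (variety S \<eta> E :: ('s, 'f, 'b) algebra set)
     (free_algebra S \<eta> E \<xi> X) (gen S \<eta> E \<xi> X ` X)"
  unfolding free_generators_def
proof (intro conjI ballI impI)
  fix A :: "('s, 'f, 'b) algebra" and k
  assume "A \<in> variety S \<eta> E" "k \<in> g ` X \<rightarrow> univ A" "\<forall>y\<in>g ` X. sort_of F y = sort_of A (k y)"
  then show "\<exists>!h. h \<in> homs S F A \<and> (\<forall>y\<in>g ` X. h y = k y)"
    using free_algebra_universal[of A "\<lambda>x. k (g x)"] sort_gen by auto
qed (use gen_in in auto)

lemma inj_on_gen:
  fixes A :: "('s, 'f, 'b) algebra"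
  assumes "A \<in> variety S \<eta> E" "\<forall>x\<in>X. h x \<in> univ A \<and> sort_of A (h x) = \<xi> x" "inj_on h X"
  shows "inj_on (gen S \<eta> E \<xi> X) X"
proof -
  obtain \<phi> where "\<forall>x\<in>X. \<phi> (g x) = h x" using free_algebra_universal[OF assms(1,2)] by auto
  then show ?thesis using assms(3) by (metis inj_onD inj_onI)
qed

end

lemma free_objects_iff:
  assumes S: "signature S" and E: "\<forall>e\<in>E. is_identity S \<eta> e" and X0: "\<xi> ` X0 \<subseteq> Sorts S"
  shows "X \<in> free_objects S \<eta> E \<xi> X0 \<longleftrightarrow> finite X \<and> X \<subseteq> X0 \<and> inj_on (gen S \<eta> E \<xi> X) X"
proof (cases "X \<subseteq> X0")
  case True
  then have X: "\<xi> ` X \<subseteq> Sorts S" using X0 by (meson image_mono subset_trans)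
  show ?thesis
    unfolding free_objects_def
    by (simp add: free_algebra_in_variety[OF S E X] free_generators_free_algebra[OF S E X])
qed (simp add: free_objects_def)

lemma homs_id: "is_algebra S A \<Longrightarrow> (\<lambda>a\<in>univ A. a) \<in> homs S A A"
proof -
  have "map (\<lambda>a\<in>univ A. a) as = as" if "as \<in> args S A f" for as f
    using that by (auto simp: args_def intro!: map_idI)
  then show "is_algebra S A \<Longrightarrow> ?thesis" by (auto simp: homs_def is_algebra_def)
qed

lemma homs_compose_id:
  assumes "\<phi> \<in> homs S A B"
  shows "compose (univ A) \<phi> (\<lambda>a\<in>univ A. a) = \<phi>" "compose (univ A) (\<lambda>b\<in>univ B. b) \<phi> = \<phi>"
proof -
  have "\<phi> \<in> univ A \<rightarrow>\<^sub>E univ B" using assms by (simp add: homs_def)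
  then show "compose (univ A) \<phi> (\<lambda>a\<in>univ A. a) = \<phi>" "compose (univ A) (\<lambda>b\<in>univ B. b) \<phi> = \<phi>"
    by (auto simp: compose_def PiE_def extensional_def fun_eq_iff)
qed

lemma homs_imp_funcset: "\<phi> \<in> homs S A B \<Longrightarrow> \<phi> \<in> univ A \<rightarrow> univ B"
  by (auto simp: homs_def)

lemma is_category_free_category: "is_category (free_category S \<eta> E \<xi> X0)"
proof -
  have alg: "is_algebra S (free_algebra S \<eta> E \<xi> X)" if "X \<in> free_objects S \<eta> E \<xi> X0" for X
    using that by (auto simp: free_objects_def variety_def)
  show ?thesis
    unfolding is_category_def free_category_def Let_def
    by (auto simp: homs_compose[OF alg] homs_id[OF alg] homs_compose_id
          intro!: compose_assoc dest: homs_imp_funcset)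
qed

lemma automorphismsD:
  assumes "\<Phi> \<in> automorphisms C"
  shows "fst \<Phi> \<in> Bij (Obj C)" "snd \<Phi> \<in> Bij (Mor C)"
    "\<And>A. A \<in> Obj C \<Longrightarrow> fst \<Phi> A \<in> Obj C" "\<And>f. f \<in> Mor C \<Longrightarrow> snd \<Phi> f \<in> Mor C"
    "\<And>f. f \<in> Mor C \<Longrightarrow> Dom C (snd \<Phi> f) = fst \<Phi> (Dom C f)"
    "\<And>f. f \<in> Mor C \<Longrightarrow> Cod C (snd \<Phi> f) = fst \<Phi> (Cod C f)"
    "\<And>A. A \<in> Obj C \<Longrightarrow> snd \<Phi> (Ident C A) = Ident C (fst \<Phi> A)"
    "\<And>f g. f \<in> Mor C \<Longrightarrow> g \<in> Mor C \<Longrightarrow> Cod C f = Dom C g \<Longrightarrow>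
       snd \<Phi> (Comp C g f) = Comp C (snd \<Phi> g) (snd \<Phi> f)"
  using assms by (auto simp: automorphisms_def dest: funcset_mem[OF Bij_imp_funcset])

lemma is_categoryD:
  assumes "is_category C"
  shows "\<And>f. f \<in> Mor C \<Longrightarrow> Dom C f \<in> Obj C" "\<And>f. f \<in> Mor C \<Longrightarrow> Cod C f \<in> Obj C"
    "\<And>A. A \<in> Obj C \<Longrightarrow> Ident C A \<in> Mor C" "\<And>A. A \<in> Obj C \<Longrightarrow> Dom C (Ident C A) = A"
    "\<And>A. A \<in> Obj C \<Longrightarrow> Cod C (Ident C A) = A"
    "\<And>f A. f \<in> Mor C \<Longrightarrow> Dom C f = A \<Longrightarrow> Comp C f (Ident C A) = f"
    "\<And>f A. f \<in> Mor C \<Longrightarrow> Cod C f = A \<Longrightarrow> Comp C (Ident C A) f = f"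
    "\<And>f g. f \<in> Mor C \<Longrightarrow> g \<in> Mor C \<Longrightarrow> Cod C f = Dom C g \<Longrightarrow> Comp C g f \<in> Mor C"
    "\<And>f g. f \<in> Mor C \<Longrightarrow> g \<in> Mor C \<Longrightarrow> Cod C f = Dom C g \<Longrightarrow> Dom C (Comp C g f) = Dom C f"
    "\<And>f g. f \<in> Mor C \<Longrightarrow> g \<in> Mor C \<Longrightarrow> Cod C f = Dom C g \<Longrightarrow> Cod C (Comp C g f) = Cod C g"
    "\<And>f g h. f \<in> Mor C \<Longrightarrow> g \<in> Mor C \<Longrightarrow> h \<in> Mor C \<Longrightarrow> Cod C f = Dom C g \<Longrightarrow> Cod C g = Dom C h \<Longrightarrow>
       Comp C h (Comp C g f) = Comp C (Comp C h g) f"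
  using assms by (auto simp: is_category_def)

lemma automorphisms_compose:
  assumes C: "is_category C" and F: "F \<in> automorphisms C" and G: "G \<in> automorphisms C"
  shows "(compose (Obj C) (fst F) (fst G), compose (Mor C) (snd F) (snd G)) \<in> automorphisms C"
  unfolding automorphisms_def
  using automorphismsD[OF F] automorphismsD[OF G] is_categoryD[OF C]
  by (auto simp: compose_eq compose_Bij)

lemma automorphisms_inverse:
  assumes C: "is_category C" and F: "F \<in> automorphisms C"
  shows "(\<lambda>A\<in>Obj C. inv_into (Obj C) (fst F) A, \<lambda>f\<in>Mor C. inv_into (Mor C) (snd F) f)
           \<in> automorphisms C" (is "(?Go, ?Gm) \<in> _")
proof -
  note c = is_categoryD[OF C] and a = automorphismsD[OF F]
  have o: "inj_on (fst F) (Obj C)" "fst F ` Obj C = Obj C"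
    and m: "inj_on (snd F) (Mor C)" "snd F ` Mor C = Mor C"
    using a(1,2) by (auto simp: Bij_def bij_betw_def)
  have Go: "?Go A \<in> Obj C" "fst F (?Go A) = A" if "A \<in> Obj C" for A
    using that o by (auto simp: f_inv_into_f intro!: inv_into_into)
  have Gm: "?Gm f \<in> Mor C" "snd F (?Gm f) = f" if "f \<in> Mor C" for f
    using that m by (auto simp: f_inv_into_f intro!: inv_into_into)
  have oI: "A = B" if "fst F A = fst F B" "A \<in> Obj C" "B \<in> Obj C" for A B
    using o(1) that by (rule inj_onD)
  have mI: "f = g" if "snd F f = snd F g" "f \<in> Mor C" "g \<in> Mor C" for f g
    using m(1) that by (rule inj_onD)
  have dom: "Dom C (?Gm f) = ?Go (Dom C f)" if f: "f \<in> Mor C" for f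
    by (rule oI) (simp_all only: a(5)[symmetric] Gm[OF f] Go[OF c(1)[OF f]] c(1))
  have cod: "Cod C (?Gm f) = ?Go (Cod C f)" if f: "f \<in> Mor C" for f
    by (rule oI) (simp_all only: a(6)[symmetric] Gm[OF f] Go[OF c(2)[OF f]] c(2))
  have idt: "?Gm (Ident C A) = Ident C (?Go A)" if A: "A \<in> Obj C" for A
    by (rule mI) (simp_all only: a(7) Gm[OF c(3)[OF A]] Go[OF A] c(3))
  have cmp: "?Gm (Comp C g f) = Comp C (?Gm g) (?Gm f)"
    if f: "f \<in> Mor C" and g: "g \<in> Mor C" and fg: "Cod C f = Dom C g" for f g
  proof -
    have e: "Cod C (?Gm f) = Dom C (?Gm g)" using dom[OF g] cod[OF f] fg by simp
    show ?thesis
      by (rule mI)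
        (simp_all only: Gm[OF c(8)[OF f g fg]] a(8)[OF Gm(1)[OF f] Gm(1)[OF g] e]
          c(8)[OF Gm(1)[OF f] Gm(1)[OF g] e] Gm(2)[OF f] Gm(2)[OF g])
  qed
  show ?thesis
    unfolding automorphisms_def
    using restrict_inv_into_Bij[OF a(1)] restrict_inv_into_Bij[OF a(2)] dom cod idt cmp
    by (simp del: restrict_apply)
qed

lemma aut_group_simps:
  "carrier (aut_group C) = automorphisms C"
  "F \<otimes>\<^bsub>aut_group C\<^esub> G = (compose (Obj C) (fst F) (fst G), compose (Mor C) (snd F) (snd G))"
  "\<one>\<^bsub>aut_group C\<^esub> = (\<lambda>A\<in>Obj C. A, \<lambda>f\<in>Mor C. f)"
  by (auto simp: aut_group_def split_beta)

lemma automorphisms_id: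
  assumes "is_category C"
  shows "(\<lambda>A\<in>Obj C. A, \<lambda>f\<in>Mor C. f) \<in> automorphisms C"
  unfolding automorphisms_def using is_categoryD[OF assms] by (auto simp: id_Bij)

lemma
  assumes C: "is_category C"
  shows group_aut_group: "group (aut_group C)"
    and inv_aut_group: "F \<in> automorphisms C \<Longrightarrow> inv\<^bsub>aut_group C\<^esub> F =
      (\<lambda>A\<in>Obj C. inv_into (Obj C) (fst F) A, \<lambda>f\<in>Mor C. inv_into (Mor C) (snd F) f)"
proof -
  have linv: "(\<lambda>A\<in>Obj C. inv_into (Obj C) (fst F) A, \<lambda>f\<in>Mor C. inv_into (Mor C) (snd F) f)
      \<otimes>\<^bsub>aut_group C\<^esub> F = \<one>\<^bsub>aut_group C\<^esub>" if "F \<in> automorphisms C" for F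
    using automorphismsD(1,2)[OF that] by (simp add: aut_group_simps Bij_compose_restrict_eq)
  show g: "group (aut_group C)"
  proof (rule groupI)
    fix F G H
    assume "F \<in> carrier (aut_group C)" "G \<in> carrier (aut_group C)" "H \<in> carrier (aut_group C)"
    then show "F \<otimes>\<^bsub>aut_group C\<^esub> G \<otimes>\<^bsub>aut_group C\<^esub> H = F \<otimes>\<^bsub>aut_group C\<^esub> (G \<otimes>\<^bsub>aut_group C\<^esub> H)"
      by (simp add: aut_group_simps automorphismsD(1,2) Bij_imp_funcset flip: compose_assoc)
  next
    fix F assume "F \<in> carrier (aut_group C)"
    then have F: "F \<in> automorphisms C" by (simp add: aut_group_simps)
    show "\<one>\<^bsub>aut_group C\<^esub> \<otimes>\<^bsub>aut_group C\<^esub> F = F"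
      using automorphismsD(1,2)[OF F]
      by (simp add: aut_group_simps Bij_imp_funcset Bij_imp_extensional)
    show "\<exists>G\<in>carrier (aut_group C). G \<otimes>\<^bsub>aut_group C\<^esub> F = \<one>\<^bsub>aut_group C\<^esub>"
      using linv[OF F] automorphisms_inverse[OF C F] by (auto simp: aut_group_simps(1))
  qed (auto simp: aut_group_simps automorphisms_compose[OF C] automorphisms_id[OF C])
  show "inv\<^bsub>aut_group C\<^esub> F =
      (\<lambda>A\<in>Obj C. inv_into (Obj C) (fst F) A, \<lambda>f\<in>Mor C. inv_into (Mor C) (snd F) f)"
    if "F \<in> automorphisms C"
    using group.inv_equality[OF g linv[OF that]] that automorphisms_inverse[OF C that]
    by (simp add: aut_group_simps(1))
qed

lemma isosI:
  assumes "m \<in> Mor C" "Dom C m = A" "Cod C m = B" "n \<in> Mor C" "Dom C n = B" "Cod C n = A"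
    "Comp C n m = Ident C A" "Comp C m n = Ident C B"
  shows "m \<in> isos C A B"
  using assms by (auto simp: isos_def)

lemma isos_comp:
  assumes C: "is_category C" and m: "m \<in> isos C A B" and k: "k \<in> isos C B D"
  shows "Comp C k m \<in> isos C A D"
proof -
  note c = is_categoryD[OF C]
  obtain n where n: "n \<in> Mor C" "Dom C n = B" "Cod C n = A" "Comp C n m = Ident C A" "Comp C m n = Ident C B"
    using m by (auto simp: isos_def)
  obtain l where l: "l \<in> Mor C" "Dom C l = D" "Cod C l = B" "Comp C l k = Ident C B" "Comp C k l = Ident C D"
    using k by (auto simp: isos_def)
  have m': "m \<in> Mor C" "Dom C m = A" "Cod C m = B" and k': "k \<in> Mor C" "Dom C k = B" "Cod C k = D"
    using m k by (auto simp: isos_def)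
  note mor = n(1-3) l(1-3) m' k' c(8-10)
  have "Comp C (Comp C n l) (Comp C k m) = Comp C n (Comp C (Comp C l k) m)"
    by (simp add: mor c(11))
  also have "\<dots> = Ident C A" by (simp add: l(4) c(7) m' n(4))
  finally have 1: "Comp C (Comp C n l) (Comp C k m) = Ident C A" .
  have "Comp C (Comp C k m) (Comp C n l) = Comp C k (Comp C (Comp C m n) l)"
    by (simp add: mor c(11))
  also have "\<dots> = Ident C D" by (simp add: n(5) c(7) l)
  finally have 2: "Comp C (Comp C k m) (Comp C n l) = Ident C D" .
  show ?thesis by (rule isosI[OF _ _ _ _ _ _ 1 2]) (simp_all add: mor)
qed

lemma isos_automorphism:
  assumes C: "is_category C" and F: "F \<in> automorphisms C" and m: "m \<in> isos C A B"
  shows "snd F m \<in> isos C (fst F A) (fst F B)"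
proof -
  note c = is_categoryD[OF C] and a = automorphismsD[OF F]
  obtain n where n: "n \<in> Mor C" "Dom C n = B" "Cod C n = A" "Comp C n m = Ident C A" "Comp C m n = Ident C B"
    using m by (auto simp: isos_def)
  have m': "m \<in> Mor C" "Dom C m = A" "Cod C m = B" using m by (auto simp: isos_def)
  have AB: "A \<in> Obj C" "B \<in> Obj C" using c(1,2) m' by auto
  show ?thesis
    by (rule isosI[where n = "snd F n"]) (simp_all add: a m' n AB flip: a(8) a(7))
qed

lemma inner_automorphisms_iff:
  "F \<in> inner_automorphisms C \<longleftrightarrow> F \<in> automorphisms C \<and>
     (\<exists>s. (\<forall>A\<in>Obj C. s A \<in> isos C A (fst F A)) \<and>
          (\<forall>f\<in>Mor C. Comp C (snd F f) (s (Dom C f)) = Comp C (s (Cod C f)) f))"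
  by (cases F) (simp add: inner_automorphisms_def)

lemma subgroup_inner_automorphisms:
  assumes C: "is_category C"
  shows "subgroup (inner_automorphisms C) (aut_group C)"
proof (rule group.subgroupI[OF group_aut_group[OF C]])
  note c = is_categoryD[OF C]
  show "inner_automorphisms C \<subseteq> carrier (aut_group C)"
    by (auto simp: inner_automorphisms_def aut_group_simps)
  have "Ident C A \<in> isos C A A" if "A \<in> Obj C" for A
    using that c by (intro isosI[where n = "Ident C A"]) auto
  then have "(\<lambda>A\<in>Obj C. A, \<lambda>f\<in>Mor C. f) \<in> inner_automorphisms C"
    using automorphisms_id[OF C] c
    by (auto simp: inner_automorphisms_def intro!: exI[of _ "Ident C"])
  then show "inner_automorphisms C \<noteq> {}" by auto
next
  note c = is_categoryD[OF C]
  fix F assume "F \<in> inner_automorphisms C"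
  then obtain s where F: "F \<in> automorphisms C"
    and s: "\<forall>A\<in>Obj C. s A \<in> isos C A (fst F A)"
    and nat: "\<forall>f\<in>Mor C. Comp C (snd F f) (s (Dom C f)) = Comp C (s (Cod C f)) f"
    by (auto simp: inner_automorphisms_def)
  define G where "G = (\<lambda>A\<in>Obj C. inv_into (Obj C) (fst F) A, \<lambda>f\<in>Mor C. inv_into (Mor C) (snd F) f)"
  have G: "G \<in> automorphisms C" unfolding G_def by (rule automorphisms_inverse[OF C F])
  note g = automorphismsD[OF G]
  have FG: "fst F (fst G A) = A" if "A \<in> Obj C" for A
    using that automorphismsD(1)[OF F] by (auto simp: G_def Bij_def bij_betw_def f_inv_into_f)
  have FGm: "snd F (snd G f) = f" if "f \<in> Mor C" for f
    using that automorphismsD(2)[OF F] by (auto simp: G_def Bij_def bij_betw_def f_inv_into_f)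
  let ?s = "\<lambda>A. s (fst G A)"
  have sG: "?s A \<in> isos C (fst G A) A" if "A \<in> Obj C" for A
    using s g(3)[OF that] FG[OF that] by metis
  have "\<exists>u. u \<in> Mor C \<and> Dom C u = A \<and> Cod C u = fst G A \<and>
      Comp C u (?s A) = Ident C (fst G A) \<and> Comp C (?s A) u = Ident C A" if "A \<in> Obj C" for A
    using sG[OF that] unfolding isos_def by blast
  then obtain u where u: "\<And>A. A \<in> Obj C \<Longrightarrow> u A \<in> Mor C \<and> Dom C (u A) = A \<and> Cod C (u A) = fst G A \<and>
      Comp C (u A) (?s A) = Ident C (fst G A) \<and> Comp C (?s A) (u A) = Ident C A"
    by metis
  have sm: "?s A \<in> Mor C" "Dom C (?s A) = fst G A" "Cod C (?s A) = A" if "A \<in> Obj C" for A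
    using sG[OF that] by (auto simp: isos_def)
  have "u A \<in> isos C A (fst G A)" if "A \<in> Obj C" for A
    using u[OF that] sm[OF that] by (intro isosI[where n = "?s A"]) auto
  moreover have "Comp C (snd G f) (u (Dom C f)) = Comp C (u (Cod C f)) f" if f: "f \<in> Mor C" for f
  proof -
    let ?A = "Dom C f" and ?B = "Cod C f" and ?g = "snd G f"
    have A: "?A \<in> Obj C" and B: "?B \<in> Obj C" using c f by auto
    note uA = u[OF A] and uB = u[OF B] and sA = sm[OF A] and sB = sm[OF B]
    have gm: "?g \<in> Mor C" "Dom C ?g = fst G ?A" "Cod C ?g = fst G ?B"
      using g(4,5,6)[OF f] by auto
    have eq: "Comp C f (?s ?A) = Comp C (?s ?B) ?g"
      using nat gm FGm[OF f] by metis
    note mor = gm uA uB sA sB f c(8-10)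
    have "Comp C (u ?B) f = Comp C (u ?B) (Comp C f (Comp C (?s ?A) (u ?A)))"
      using uA f c(6) by auto
    also have "\<dots> = Comp C (u ?B) (Comp C (Comp C f (?s ?A)) (u ?A))"
      using mor by (subst c(11)) auto
    also have "\<dots> = Comp C (Comp C (Comp C (u ?B) (?s ?B)) ?g) (u ?A)"
      unfolding eq using mor by (simp add: c(11))
    also have "\<dots> = Comp C ?g (u ?A)"
      using mor by (simp add: c(7))
    finally show ?thesis ..
  qed
  ultimately have "G \<in> inner_automorphisms C"
    using G by (auto simp: inner_automorphisms_def intro!: exI[of _ u])
  then show "inv\<^bsub>aut_group C\<^esub> F \<in> inner_automorphisms C"
    by (simp only: inv_aut_group[OF C F] G_def)
next
  note c = is_categoryD[OF C]
  fix F G assume F': "F \<in> inner_automorphisms C" and G': "G \<in> inner_automorphisms C"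
  from F' obtain s where F: "F \<in> automorphisms C"
    and s: "\<And>A. A \<in> Obj C \<Longrightarrow> s A \<in> isos C A (fst F A)"
    and ns: "\<And>f. f \<in> Mor C \<Longrightarrow> Comp C (snd F f) (s (Dom C f)) = Comp C (s (Cod C f)) f"
    unfolding inner_automorphisms_iff by blast
  from G' obtain t where G: "G \<in> automorphisms C"
    and t: "\<And>A. A \<in> Obj C \<Longrightarrow> t A \<in> isos C A (fst G A)"
    and nt: "\<And>f. f \<in> Mor C \<Longrightarrow> Comp C (snd G f) (t (Dom C f)) = Comp C (t (Cod C f)) f"
    unfolding inner_automorphisms_iff by blast
  note a = automorphismsD[OF F] and b = automorphismsD[OF G]
  define w where "w A = Comp C (snd F (t A)) (s A)" for A
  have w: "w A \<in> isos C A (fst F (fst G A))" if "A \<in> Obj C" for A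
    unfolding w_def by (rule isos_comp[OF C s[OF that] isos_automorphism[OF C F t[OF that]]])
  have "Comp C (snd F (snd G f)) (w (Dom C f)) = Comp C (w (Cod C f)) f" if f: "f \<in> Mor C" for f
  proof -
    let ?A = "Dom C f" and ?B = "Cod C f"
    have A: "?A \<in> Obj C" and B: "?B \<in> Obj C" using c f by auto
    have sm: "s ?A \<in> Mor C" "Dom C (s ?A) = ?A" "Cod C (s ?A) = fst F ?A"
      "s ?B \<in> Mor C" "Dom C (s ?B) = ?B" "Cod C (s ?B) = fst F ?B"
      using s[OF A] s[OF B] by (auto simp: isos_def)
    have tm: "t ?A \<in> Mor C" "Dom C (t ?A) = ?A" "Cod C (t ?A) = fst G ?A"
      "t ?B \<in> Mor C" "Dom C (t ?B) = ?B" "Cod C (t ?B) = fst G ?B"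
      using t[OF A] t[OF B] by (auto simp: isos_def)
    note mor = sm tm f a(4,5,6) b(4,5,6)
    have "Comp C (snd F (snd G f)) (w ?A) = Comp C (snd F (Comp C (snd G f) (t ?A))) (s ?A)"
      unfolding w_def by (simp add: mor c(11) a(8))
    also have "\<dots> = Comp C (snd F (t ?B)) (Comp C (snd F f) (s ?A))"
      unfolding nt[OF f] by (simp add: mor c(11) a(8))
    also have "\<dots> = Comp C (w ?B) f"
      unfolding ns[OF f] w_def by (simp add: mor c(11))
    finally show ?thesis .
  qed
  then show "F \<otimes>\<^bsub>aut_group C\<^esub> G \<in> inner_automorphisms C"
    using w automorphisms_compose[OF C F G] c(1,2)
    by (auto simp: inner_automorphisms_def aut_group_simps compose_eq intro!: exI[of _ w])
qed

lemma subgroup_strongly_stable_automorphisms: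
  fixes \<xi> :: "'x \<Rightarrow> 's"
  shows "subgroup (strongly_stable_automorphisms S \<eta> E \<xi> X0) (aut_group (free_category S \<eta> E \<xi> X0))"
proof -
  let ?C = "free_category S \<eta> E \<xi> X0" and ?F = "free_algebra S \<eta> E \<xi>"
  let ?U = "\<lambda>X. univ (free_algebra S \<eta> E \<xi> X)" and ?g = "gen S \<eta> E \<xi>"
  define ok where "ok s \<longleftrightarrow> (\<forall>X\<in>Obj ?C. bij_betw (s X) (?U X) (?U X) \<and>
      (\<forall>a\<in>?U X. sort_of (?F X) a = sort_of (?F X) (s X a)) \<and> (\<forall>x\<in>X. s X (?g X x) = ?g X x))" for s
  define cnj where "cnj \<Phi> s \<longleftrightarrow> (\<forall>X \<mu> Y. (X, \<mu>, Y) \<in> Mor ?C \<longrightarrow>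
      snd \<Phi> (X, \<mu>, Y) = (X, \<lambda>a\<in>?U X. s Y (\<mu> (inv_into (?U X) (s X) a)), Y))"
    for \<Phi> :: "('x set \<Rightarrow> 'x set) \<times> _" and s
  have C: "is_category ?C" by (rule is_category_free_category)
  note c = is_categoryD[OF C]
  have iff: "\<Phi> \<in> strongly_stable_automorphisms S \<eta> E \<xi> X0 \<longleftrightarrow>
      \<Phi> \<in> automorphisms ?C \<and> (\<forall>X\<in>Obj ?C. fst \<Phi> X = X) \<and> (\<exists>s. ok s \<and> cnj \<Phi> s)" for \<Phi>
    by (cases \<Phi>) (simp add: strongly_stable_automorphisms_def ok_def cnj_def Let_def)
  have I: "\<Phi> \<in> strongly_stable_automorphisms S \<eta> E \<xi> X0"
    if "\<Phi> \<in> automorphisms ?C" "\<forall>X\<in>Obj ?C. fst \<Phi> X = X" "ok s" "cnj \<Phi> s" for \<Phi> s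
    using that unfolding iff by blast
  have mor: "X \<in> Obj ?C" "Y \<in> Obj ?C" "\<mu> \<in> ?U X \<rightarrow>\<^sub>E ?U Y" "\<And>a. a \<in> ?U X \<Longrightarrow> \<mu> a \<in> ?U Y"
    if "(X, \<mu>, Y) \<in> Mor ?C" for X \<mu> Y
    using that by (auto simp: free_category_def homs_def Let_def)
  have genU: "?g X x \<in> ?U X" if "X \<in> Obj ?C" "x \<in> X" for X x
    using that by (auto simp: free_category_def free_objects_def free_generators_def Let_def)
  show ?thesis
  proof (rule group.subgroupI[OF group_aut_group[OF C]])
    show "strongly_stable_automorphisms S \<eta> E \<xi> X0 \<subseteq> carrier (aut_group ?C)"
      using iff by (auto simp: aut_group_simps)
    have "(\<lambda>a\<in>?U X. \<mu> (inv_into (?U X) (\<lambda>a. a) a)) = \<mu>" if "(X, \<mu>, Y) \<in> Mor ?C" for X \<mu> Y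
    proof (rule extensionalityI[of _ "?U X"])
      show "\<mu> \<in> extensional (?U X)" using mor(3)[OF that] by (simp add: PiE_def)
      fix a assume a: "a \<in> ?U X"
      then have "inv_into (?U X) (\<lambda>a. a) a = a" by (intro inv_into_f_eq) auto
      then show "(\<lambda>a\<in>?U X. \<mu> (inv_into (?U X) (\<lambda>a. a) a)) a = \<mu> a" using a by simp
    qed simp
    then have 1: "cnj (\<lambda>A\<in>Obj ?C. A, \<lambda>f\<in>Mor ?C. f) (\<lambda>X a. a)" by (simp add: cnj_def)
    have 2: "ok (\<lambda>X a. a)" by (simp add: ok_def bij_betw_def)
    have 3: "\<forall>X\<in>Obj ?C. fst (\<lambda>A\<in>Obj ?C. A, \<lambda>f\<in>Mor ?C. f) X = X" by simp
    have "(\<lambda>A\<in>Obj ?C. A, \<lambda>f\<in>Mor ?C. f) \<in> strongly_stable_automorphisms S \<eta> E \<xi> X0"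
      using I[OF automorphisms_id[OF C] 3 2 1] .
    then show "strongly_stable_automorphisms S \<eta> E \<xi> X0 \<noteq> {}" by blast
  next
    fix \<Phi> assume "\<Phi> \<in> strongly_stable_automorphisms S \<eta> E \<xi> X0"
    then obtain s where \<Phi>: "\<Phi> \<in> automorphisms ?C" "\<forall>X\<in>Obj ?C. fst \<Phi> X = X" and s: "ok s" and cj: "cnj \<Phi> s"
      unfolding iff by blast
    let ?G = "(\<lambda>A\<in>Obj ?C. inv_into (Obj ?C) (fst \<Phi>) A, \<lambda>f\<in>Mor ?C. inv_into (Mor ?C) (snd \<Phi>) f)"
    have G: "?G \<in> automorphisms ?C" by (rule automorphisms_inverse[OF C \<Phi>(1)])
    have inj: "inj_on (fst \<Phi>) (Obj ?C)" "inj_on (snd \<Phi>) (Mor ?C)" "snd \<Phi> ` Mor ?C = Mor ?C"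
      using automorphismsD(1,2)[OF \<Phi>(1)] by (auto simp: Bij_def bij_betw_def)
    have Go: "\<forall>X\<in>Obj ?C. fst ?G X = X"
    proof
      fix X assume X: "X \<in> Obj ?C"
      have "inv_into (Obj ?C) (fst \<Phi>) X = X" using \<Phi>(2) X by (intro inv_into_f_eq[OF inj(1)]) auto
      then show "fst ?G X = X" using X by simp
    qed
    define t where "t X = inv_into (?U X) (s X)" for X
    have bs: "bij_betw (s X) (?U X) (?U X)"
      and ss: "\<And>a. a \<in> ?U X \<Longrightarrow> sort_of (?F X) (s X a) = sort_of (?F X) a"
      and sg: "\<And>x. x \<in> X \<Longrightarrow> s X (?g X x) = ?g X x" if "X \<in> Obj ?C" for X
      using s that by (simp_all add: ok_def)
    have t: "t X a \<in> ?U X" "s X (t X a) = a" "t X (s X a) = a" "s X a \<in> ?U X"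
      "inv_into (?U X) (t X) a = s X a"
      if "X \<in> Obj ?C" "a \<in> ?U X" for X a
    proof -
      show 1: "t X a \<in> ?U X" "s X (t X a) = a" "t X (s X a) = a" "s X a \<in> ?U X"
        using bs[OF that(1)] that(2)
        by (auto simp: t_def bij_betw_def inv_into_into f_inv_into_f)
      show "inv_into (?U X) (t X) a = s X a"
        using inv_into_inv_into_eq[OF bs[OF that(1)] that(2)] by (simp add: t_def)
    qed
    have ok: "ok t"
      unfolding ok_def
    proof (intro ballI conjI)
      fix X assume X: "X \<in> Obj ?C"
      show "bij_betw (t X) (?U X) (?U X)" unfolding t_def by (rule bij_betw_inv_into[OF bs[OF X]])
      show "sort_of (?F X) a = sort_of (?F X) (t X a)" if "a \<in> ?U X" for a
        using ss[OF X t(1)[OF X that]] t(2)[OF X that] by simp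
      show "t X (?g X x) = ?g X x" if "x \<in> X" for x
        using t(3)[OF X genU[OF X that]] sg[OF X that] by simp
    qed
    have cjt: "cnj ?G t"
      unfolding cnj_def
    proof (intro allI impI)
      fix X \<mu> Y assume m: "(X, \<mu>, Y) \<in> Mor ?C"
      note XY = mor(1,2)[OF m]
      have "(X, \<mu>, Y) \<in> snd \<Phi> ` Mor ?C" unfolding inj(3) by (rule m)
      then obtain n where n: "n \<in> Mor ?C" "snd \<Phi> n = (X, \<mu>, Y)" by fastforce
      obtain X' \<nu> Y' where n': "n = (X', \<nu>, Y')" by (cases n)
      have "snd \<Phi> n = (X', \<lambda>a\<in>?U X'. s Y' (\<nu> (inv_into (?U X') (s X') a)), Y')"
        using cj n(1) unfolding n' cnj_def by blast
      then have e: "X' = X" "Y' = Y" "\<mu> = (\<lambda>a\<in>?U X. s Y (\<nu> (inv_into (?U X) (s X) a)))"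
        unfolding n(2) by simp_all
      have \<nu>: "\<nu> a \<in> ?U Y" if "a \<in> ?U X" for a using mor(4) n(1) n' e(1,2) that by blast
      have "\<nu> = (\<lambda>a\<in>?U X. t Y (\<mu> (s X a)))"
      proof (rule extensionalityI[of _ "?U X"])
        show "\<nu> \<in> extensional (?U X)" using mor(3) n(1) n' e(1,2) by (auto simp: PiE_def)
        show "\<nu> a = (\<lambda>a\<in>?U X. t Y (\<mu> (s X a))) a" if "a \<in> ?U X" for a
          using that t[OF XY(1) that] t(3)[OF XY(2) \<nu>[OF that]] by (simp add: e(3) flip: t_def)
      qed simp
      also have "\<dots> = (\<lambda>a\<in>?U X. t Y (\<mu> (inv_into (?U X) (t X) a)))"
        using t(5)[OF XY(1)] by (intro restrict_ext) simp
      finally have "n = (X, \<lambda>a\<in>?U X. t Y (\<mu> (inv_into (?U X) (t X) a)), Y)" using n' e(1,2) by simp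
      moreover have "snd ?G (X, \<mu>, Y) = n" using m inv_into_f_eq[OF inj(2) n] by simp
      ultimately show "snd ?G (X, \<mu>, Y) = (X, \<lambda>a\<in>?U X. t Y (\<mu> (inv_into (?U X) (t X) a)), Y)" by simp
    qed
    have "?G \<in> strongly_stable_automorphisms S \<eta> E \<xi> X0"
      by (rule I[OF G Go ok cjt])
    then show "inv\<^bsub>aut_group ?C\<^esub> \<Phi> \<in> strongly_stable_automorphisms S \<eta> E \<xi> X0"
      by (simp only: inv_aut_group[OF C \<Phi>(1)])
  next
    fix \<Phi> \<Psi>
    assume "\<Phi> \<in> strongly_stable_automorphisms S \<eta> E \<xi> X0" "\<Psi> \<in> strongly_stable_automorphisms S \<eta> E \<xi> X0"
    then obtain s t where \<Phi>: "\<Phi> \<in> automorphisms ?C" "\<forall>X\<in>Obj ?C. fst \<Phi> X = X" and s: "ok s" and cs: "cnj \<Phi> s"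
      and \<Psi>: "\<Psi> \<in> automorphisms ?C" "\<forall>X\<in>Obj ?C. fst \<Psi> X = X" and t: "ok t" and ct: "cnj \<Psi> t"
      unfolding iff by blast
    define w where "w X a = s X (t X a)" for X a
    have bs: "bij_betw (s X) (?U X) (?U X)" "bij_betw (t X) (?U X) (?U X)"
      and ss: "\<And>a. a \<in> ?U X \<Longrightarrow> sort_of (?F X) (s X a) = sort_of (?F X) a"
        "\<And>a. a \<in> ?U X \<Longrightarrow> sort_of (?F X) (t X a) = sort_of (?F X) a"
      and sg: "\<And>x. x \<in> X \<Longrightarrow> s X (?g X x) = ?g X x" "\<And>x. x \<in> X \<Longrightarrow> t X (?g X x) = ?g X x"
      if "X \<in> Obj ?C" for X
      using s t that by (simp_all add: ok_def)
    have st: "s X a \<in> ?U X" "t X a \<in> ?U X" "inv_into (?U X) (s X) a \<in> ?U X"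
      "inv_into (?U X) (t X) a \<in> ?U X" "s X (inv_into (?U X) (s X) a) = a" "t X (inv_into (?U X) (t X) a) = a"
      if "X \<in> Obj ?C" "a \<in> ?U X" for X a
      using bs[OF that(1)] that(2) by (auto simp: bij_betw_def inv_into_into f_inv_into_f)
    have bw: "bij_betw (w X) (?U X) (?U X)" if "X \<in> Obj ?C" for X
      using bij_betw_trans[OF bs(2)[OF that] bs(1)[OF that]] by (simp add: w_def[abs_def] o_def)
    have wi: "inv_into (?U X) (w X) a = inv_into (?U X) (t X) (inv_into (?U X) (s X) a)"
      if "X \<in> Obj ?C" "a \<in> ?U X" for X a
      using bw[OF that(1)] st[OF that(1)] that(2)
      by (intro inv_into_f_eq) (auto simp: w_def bij_betw_def)
    have ok: "ok w"
      unfolding ok_def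
    proof (intro ballI conjI)
      fix X assume X: "X \<in> Obj ?C"
      show "bij_betw (w X) (?U X) (?U X)" by (rule bw[OF X])
      show "sort_of (?F X) a = sort_of (?F X) (w X a)" if "a \<in> ?U X" for a
        using ss[OF X] st(2)[OF X that] that by (simp add: w_def)
      show "w X (?g X x) = ?g X x" if "x \<in> X" for x
        using sg[OF X that] by (simp add: w_def)
    qed
    have "snd \<Phi> (snd \<Psi> (X, \<mu>, Y)) = (X, \<lambda>a\<in>?U X. w Y (\<mu> (inv_into (?U X) (w X) a)), Y)"
      if m: "(X, \<mu>, Y) \<in> Mor ?C" for X \<mu> Y
    proof -
      note XY = mor(1,2)[OF m]
      have p: "snd \<Psi> (X, \<mu>, Y) = (X, \<lambda>a\<in>?U X. t Y (\<mu> (inv_into (?U X) (t X) a)), Y)" using ct m by (simp add: cnj_def)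
      have "(X, \<lambda>a\<in>?U X. t Y (\<mu> (inv_into (?U X) (t X) a)), Y) \<in> Mor ?C"
        using automorphismsD(4)[OF \<Psi>(1) m] unfolding p .
      then have "snd \<Phi> (snd \<Psi> (X, \<mu>, Y)) = (X, \<lambda>a\<in>?U X. s Y ((\<lambda>a\<in>?U X. t Y (\<mu> (inv_into (?U X) (t X) a)))
          (inv_into (?U X) (s X) a)), Y)" using cs unfolding p cnj_def by blast
      also have "\<dots> = (X, \<lambda>a\<in>?U X. w Y (\<mu> (inv_into (?U X) (w X) a)), Y)"
        using st(3)[OF XY(1)] wi[OF XY(1)] by (simp add: w_def cong: restrict_cong)
      finally show ?thesis .
    qed
    then have cjw: "cnj (\<Phi> \<otimes>\<^bsub>aut_group ?C\<^esub> \<Psi>) w"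
      by (simp add: cnj_def aut_group_simps compose_eq)
    have o: "\<forall>X\<in>Obj ?C. fst (\<Phi> \<otimes>\<^bsub>aut_group ?C\<^esub> \<Psi>) X = X"
      using \<Phi>(2) \<Psi>(2) by (simp add: aut_group_simps compose_eq)
    have "\<Phi> \<otimes>\<^bsub>aut_group ?C\<^esub> \<Psi> \<in> automorphisms ?C"
      using automorphisms_compose[OF C \<Phi>(1) \<Psi>(1)] by (simp add: aut_group_simps)
    then show "\<Phi> \<otimes>\<^bsub>aut_group ?C\<^esub> \<Psi> \<in> strongly_stable_automorphisms S \<eta> E \<xi> X0"
      by (rule I[OF _ o ok cjw])
  qed
qed

end

theory Submission
  imports Defs
begin

text \<open>Fix a letter \<open>b i\<close> of every sort \<open>i\<close>. An element \<open>a \<in> F(X)\<close> of sort \<open>i\<close> is the same as a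
  homomorphism \<open>F(b i) \<rightarrow> F(X)\<close>, and freeness of \<open>F(X)\<close> says that the homomorphisms belonging to
  the letters of \<open>X\<close> make \<open>F(X)\<close> a coproduct of the algebras \<open>F(b i)\<close>. An automorphism \<open>\<Phi>\<close>
  preserves coproducts, so isomorphisms \<open>F(b i) \<cong> \<Phi>(F(b i))\<close> extend to isomorphisms
  \<open>F(X) \<cong> \<Phi>(F(X))\<close> compatible with the coproduct injections. Conjugation by them is inner, and
  dividing it off leaves an automorphism \<open>\<Psi>\<close> fixing all objects and all injections. Acting with
  \<open>\<Psi>\<close> on the homomorphisms \<open>F(b i) \<rightarrow> F(X)\<close>, that is, on the elements of \<open>F(X)\<close>, gives the
  bijections that show \<open>\<Psi>\<close> to be strongly stable. The other order of the factors follows by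
  inverting.\<close>

section \<open>Conjugating a category by a family of isomorphisms\<close>

lemma isos_cancel_right:
  assumes C: "is_category C" and t: "t \<in> isos C A B"
    and f: "f \<in> Mor C" "Dom C f = B" and g: "g \<in> Mor C" "Dom C g = B"
    and eq: "Comp C f t = Comp C g t"
  shows "f = g"
proof -
  note c = is_categoryD[OF C]
  obtain u where t': "t \<in> Mor C" "Dom C t = A" "Cod C t = B"
    and u: "u \<in> Mor C" "Dom C u = B" "Cod C u = A" "Comp C t u = Ident C B"
    using t unfolding isos_def by blast
  have "Comp C (Comp C f t) u = f" "Comp C (Comp C g t) u = g"
    by (simp_all add: f g t' u c(6) flip: c(11))
  then show ?thesis using eq by metis
qed

text \<open>Naturality leaves one candidate for the morphism part: \<open>f\<close> goes to
  \<open>t\<close> at its codomain, after \<open>f\<close>, after the inverse of \<open>t\<close> at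
  its domain. Functoriality follows by pasting naturality squares, and the bijection of
  \<open>F\<close> on objects makes the candidate bijective on morphisms.\<close>

lemma conjugation_inner_automorphism:
  assumes C: "is_category C" and F: "F \<in> automorphisms C"
    and t: "\<And>A. A \<in> Obj C \<Longrightarrow> t A \<in> isos C A (fst F A)"
  obtains G where "G \<in> inner_automorphisms C" "fst G = fst F"
    "\<And>f. f \<in> Mor C \<Longrightarrow> Comp C (snd G f) (t (Dom C f)) = Comp C (t (Cod C f)) f"
proof -
  note c = is_categoryD[OF C] and a = automorphismsD[OF F]
  have "\<exists>u. u \<in> Mor C \<and> Dom C u = fst F A \<and> Cod C u = A \<and>
      Comp C u (t A) = Ident C A \<and> Comp C (t A) u = Ident C (fst F A)" if "A \<in> Obj C" for A
    using t[OF that] unfolding isos_def by blast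
  then obtain u where u: "u A \<in> Mor C" "Dom C (u A) = fst F A" "Cod C (u A) = A"
    "Comp C (u A) (t A) = Ident C A" "Comp C (t A) (u A) = Ident C (fst F A)"
    if "A \<in> Obj C" for A
    by metis
  have tm: "t A \<in> Mor C" "Dom C (t A) = A" "Cod C (t A) = fst F A" if "A \<in> Obj C" for A
    using t[OF that] by (auto simp: isos_def)
  have ut: "Comp C (u A) (Comp C (t A) f) = f" if "A \<in> Obj C" "f \<in> Mor C" "Cod C f = A" for A f
    using that u[OF that(1)] tm[OF that(1)] by (simp add: c(11) c(7))
  have tu: "Comp C (t A) (Comp C (u A) f) = f"
    if "A \<in> Obj C" "f \<in> Mor C" "Cod C f = fst F A" for A f
    using that u[OF that(1)] tm[OF that(1)] by (simp add: c(11) c(7))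
  have ut': "Comp C (Comp C f (u A)) (t A) = f" if "A \<in> Obj C" "f \<in> Mor C" "Dom C f = A" for A f
    using that u[OF that(1)] tm[OF that(1)] by (simp add: c(6) flip: c(11))
  have tu': "Comp C (Comp C f (t A)) (u A) = f"
    if "A \<in> Obj C" "f \<in> Mor C" "Dom C f = fst F A" for A f
    using that u[OF that(1)] tm[OF that(1)] by (simp add: c(6) flip: c(11))
  define Gm where "Gm = (\<lambda>f\<in>Mor C. Comp C (t (Cod C f)) (Comp C f (u (Dom C f))))"
  have Gm: "Gm f \<in> Mor C" "Dom C (Gm f) = fst F (Dom C f)" "Cod C (Gm f) = fst F (Cod C f)"
    and nat: "Comp C (Gm f) (t (Dom C f)) = Comp C (t (Cod C f)) f" if f: "f \<in> Mor C" for f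
  proof -
    note m = u[OF c(1)[OF f]] tm[OF c(2)[OF f]] tm[OF c(1)[OF f]] f c(8-10)
    show "Gm f \<in> Mor C" "Dom C (Gm f) = fst F (Dom C f)" "Cod C (Gm f) = fst F (Cod C f)"
      by (simp_all add: Gm_def m)
    have "Comp C (Gm f) (t (Dom C f)) =
        Comp C (t (Cod C f)) (Comp C (Comp C f (u (Dom C f))) (t (Dom C f)))"
      unfolding Gm_def using f by (simp add: m flip: c(11))
    then show "Comp C (Gm f) (t (Dom C f)) = Comp C (t (Cod C f)) f"
      using ut'[OF c(1)[OF f] f] by simp
  qed
  \<comment> \<open>the square of naturality determines its top edge\<close>
  have Gm_eq: "Gm f = h"
    if "f \<in> Mor C" "h \<in> Mor C" "Dom C h = fst F (Dom C f)"
      "Comp C h (t (Dom C f)) = Comp C (t (Cod C f)) f" for f h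
    using isos_cancel_right[OF C t[OF c(1)] _ _ _ _ HOL.trans[OF nat that(4)[symmetric]]] Gm that
    by blast
  have inj: "inj_on Gm (Mor C)"
  proof (rule inj_onI)
    fix f g assume f: "f \<in> Mor C" and g: "g \<in> Mor C" and eq: "Gm f = Gm g"
    \<comment> \<open>Equal conjugates have the same ends after \<open>fst F\<close>, hence the same
      ends; only then do both naturality squares involve the same \<open>t\<close>, which
      cancels.\<close>
    have "inj_on (fst F) (Obj C)" using a(1) by (auto simp: Bij_def bij_betw_def)
    then have d: "Dom C f = Dom C g" "Cod C f = Cod C g"
      using eq Gm(2,3)[OF f] Gm(2,3)[OF g] c(1,2) f g by (metis inj_onD)+
    have "Comp C (t (Cod C f)) f = Comp C (t (Cod C f)) g" using nat[OF f] nat[OF g] eq d by simp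
    then show "f = g" using ut[OF c(2)[OF f] f] ut[OF c(2)[OF f] g] d by simp
  qed
  have "h \<in> Gm ` Mor C" if h: "h \<in> Mor C" for h
  proof -
    have "fst F ` Obj C = Obj C" using a(1) by (auto simp: Bij_def bij_betw_def)
    then obtain A B where A: "A \<in> Obj C" "fst F A = Dom C h" and B: "B \<in> Obj C" "fst F B = Cod C h"
      using c(1,2)[OF h] by (metis imageE)
    \<comment> \<open>The preimage of \<open>h\<close> is obtained by conjugating back.\<close>
    let ?f = "Comp C (u B) (Comp C h (t A))"
    note m = u[OF B(1)] tm[OF A(1)] A B h c(8-10)
    have f: "?f \<in> Mor C" "Dom C ?f = A" "Cod C ?f = B" by (simp_all add: m)
    have "Comp C (t B) ?f = Comp C h (t A)"
      using tu[OF B(1)] by (simp add: m)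
    then have "Gm ?f = h" using f A h by (intro Gm_eq) auto
    then show ?thesis using f(1) by (metis imageI)
  qed
  then have "Gm \<in> Bij (Mor C)"
    using inj Gm(1) by (auto simp: Bij_def bij_betw_def Gm_def)
  moreover have "Gm (Ident C A) = Ident C (fst F A)" if A: "A \<in> Obj C" for A
    using A a(3) tm[OF A] by (intro Gm_eq) (auto simp: c)
  moreover have "Gm (Comp C g f) = Comp C (Gm g) (Gm f)"
    if f: "f \<in> Mor C" and g: "g \<in> Mor C" and fg: "Cod C f = Dom C g" for f g
  proof (rule Gm_eq)
    note m = f g fg c(8-10) Gm c(1,2) tm
    show "Comp C g f \<in> Mor C" "Comp C (Gm g) (Gm f) \<in> Mor C"
      "Dom C (Comp C (Gm g) (Gm f)) = fst F (Dom C (Comp C g f))" by (simp_all add: m)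
    have "Comp C (Comp C (Gm g) (Gm f)) (t (Dom C f)) = Comp C (Gm g) (Comp C (t (Cod C f)) f)"
      using nat[OF f] by (simp add: m flip: c(11))
    also have "\<dots> = Comp C (Comp C (Gm g) (t (Dom C g))) f"
      using fg c(1)[OF g] by (subst c(11)) (simp_all add: m)
    also have "\<dots> = Comp C (t (Cod C g)) (Comp C g f)"
      unfolding nat[OF g] by (simp add: m flip: c(11))
    finally show "Comp C (Comp C (Gm g) (Gm f)) (t (Dom C (Comp C g f))) =
        Comp C (t (Cod C (Comp C g f))) (Comp C g f)" by (simp add: m)
  qed
  ultimately have "(fst F, Gm) \<in> inner_automorphisms C"
    using a(1) Gm nat t by (auto simp: inner_automorphisms_iff automorphisms_def intro!: exI[of _ t])
  then show ?thesis using nat that by auto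
qed

section \<open>Coproducts and their behaviour under automorphisms\<close>

text \<open>The legs form a set and serve as their own indices: a competing cocone assigns to each
  leg \<open>e\<close> a morphism \<open>k e\<close> with the same domain, so the summands need not
  be listed separately. For empty \<open>J\<close> this says that \<open>X\<close> is
  initial.\<close>

definition coproduct :: "('o, 'm) category \<Rightarrow> 'm set \<Rightarrow> 'o \<Rightarrow> bool" where
  "coproduct C J X \<longleftrightarrow> X \<in> Obj C \<and> J \<subseteq> Mor C \<and> (\<forall>e\<in>J. Cod C e = X) \<and>
     (\<forall>Y\<in>Obj C. \<forall>k. (\<forall>e\<in>J. k e \<in> Mor C \<and> Dom C (k e) = Dom C e \<and> Cod C (k e) = Y) \<longrightarrow>
       (\<exists>!g. g \<in> Mor C \<and> Dom C g = X \<and> Cod C g = Y \<and> (\<forall>e\<in>J. Comp C g e = k e)))"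

lemma coproductD:
  assumes "coproduct C J X"
  shows "X \<in> Obj C" "\<And>e. e \<in> J \<Longrightarrow> e \<in> Mor C" "\<And>e. e \<in> J \<Longrightarrow> Cod C e = X"
proof -
  have "X \<in> Obj C \<and> J \<subseteq> Mor C \<and> (\<forall>e\<in>J. Cod C e = X)"
    using assms unfolding coproduct_def by (elim conjE) (intro conjI)
  then show "X \<in> Obj C" "\<And>e. e \<in> J \<Longrightarrow> e \<in> Mor C" "\<And>e. e \<in> J \<Longrightarrow> Cod C e = X"
    by blast+
qed

lemma coproduct_ex1:
  assumes "coproduct C J X" "Y \<in> Obj C"
    "\<And>e. e \<in> J \<Longrightarrow> k e \<in> Mor C \<and> Dom C (k e) = Dom C e \<and> Cod C (k e) = Y"
  shows "\<exists>!g. g \<in> Mor C \<and> Dom C g = X \<and> Cod C g = Y \<and> (\<forall>e\<in>J. Comp C g e = k e)"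
proof -
  from assms(1) have "\<forall>Y\<in>Obj C. \<forall>k.
      (\<forall>e\<in>J. k e \<in> Mor C \<and> Dom C (k e) = Dom C e \<and> Cod C (k e) = Y) \<longrightarrow>
      (\<exists>!g. g \<in> Mor C \<and> Dom C g = X \<and> Cod C g = Y \<and> (\<forall>e\<in>J. Comp C g e = k e))"
    unfolding coproduct_def by (elim conjE)
  from this[THEN bspec, OF assms(2), THEN spec, of k, THEN mp] show ?thesis
    using assms(3) by simp
qed

lemma coproduct_ex:
  assumes "coproduct C J X" "Y \<in> Obj C"
    "\<And>e. e \<in> J \<Longrightarrow> k e \<in> Mor C \<and> Dom C (k e) = Dom C e \<and> Cod C (k e) = Y"
  obtains g where "g \<in> Mor C" "Dom C g = X" "Cod C g = Y" "\<And>e. e \<in> J \<Longrightarrow> Comp C g e = k e"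
  using ex1_implies_ex[OF coproduct_ex1[OF assms]] that by blast

text \<open>The identity also mediates from the cocone to itself, so uniqueness applies. This is how
  both composites in \<open>coproduct_automorphism_iso\<close> are recognised.\<close>

lemma coproduct_id:
  assumes C: "is_category C" and X: "coproduct C J X"
    and g: "g \<in> Mor C" "Dom C g = X" "Cod C g = X" "\<And>e. e \<in> J \<Longrightarrow> Comp C g e = e"
  shows "g = Ident C X"
proof -
  note c = is_categoryD[OF C] and x = coproductD[OF X]
  have ex1: "\<exists>!g. g \<in> Mor C \<and> Dom C g = X \<and> Cod C g = X \<and> (\<forall>e\<in>J. Comp C g e = e)"
    using x by (intro coproduct_ex1[OF X, of X "\<lambda>e. e"]) auto
  have 1: "Ident C X \<in> Mor C \<and> Dom C (Ident C X) = X \<and> Cod C (Ident C X) = X \<and>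
      (\<forall>e\<in>J. Comp C (Ident C X) e = e)"
    using x by (simp add: c)
  have 2: "g \<in> Mor C \<and> Dom C g = X \<and> Cod C g = X \<and> (\<forall>e\<in>J. Comp C g e = e)"
    using g by simp
  show ?thesis using the1_equality[OF ex1 1] the1_equality[OF ex1 2] by simp
qed

text \<open>Both \<open>X\<close> and its image are coproducts of isomorphic summands, and
  \<open>t\<close> is the mediating morphism. The universal property is used at \<open>X\<close>
  alone: whatever concerns morphisms out of \<open>fst F X\<close> is pulled back along
  \<open>F\<close>, settled there, and transported again.\<close>

lemma coproduct_automorphism_iso:
  assumes C: "is_category C" and F: "F \<in> automorphisms C" and X: "coproduct C J X"
    and \<sigma>: "\<And>e. e \<in> J \<Longrightarrow> \<sigma> (Dom C e) \<in> isos C (Dom C e) (fst F (Dom C e))"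
  obtains t where "t \<in> isos C X (fst F X)"
    "\<And>e. e \<in> J \<Longrightarrow> Comp C t e = Comp C (snd F e) (\<sigma> (Dom C e))"
proof -
  note c = is_categoryD[OF C] and a = automorphismsD[OF F] and x = coproductD[OF X]
  have oi: "inj_on (fst F) (Obj C)" "fst F ` Obj C = Obj C"
    and mi: "inj_on (snd F) (Mor C)" "snd F ` Mor C = Mor C"
    using a(1,2) by (auto simp: Bij_def bij_betw_def)
  have s: "\<sigma> (Dom C e) \<in> Mor C" "Dom C (\<sigma> (Dom C e)) = Dom C e"
    "Cod C (\<sigma> (Dom C e)) = fst F (Dom C e)" if "e \<in> J" for e
    using \<sigma>[OF that] by (auto simp: isos_def)
  have "\<exists>u. u \<in> Mor C \<and> Dom C u = fst F (Dom C e) \<and> Cod C u = Dom C e \<and>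
      Comp C u (\<sigma> (Dom C e)) = Ident C (Dom C e) \<and>
      Comp C (\<sigma> (Dom C e)) u = Ident C (fst F (Dom C e))" if "e \<in> J" for e
    using \<sigma>[OF that] unfolding isos_def by blast
  then obtain u where u: "u e \<in> Mor C" "Dom C (u e) = fst F (Dom C e)" "Cod C (u e) = Dom C e"
    "Comp C (u e) (\<sigma> (Dom C e)) = Ident C (Dom C e)"
    "Comp C (\<sigma> (Dom C e)) (u e) = Ident C (fst F (Dom C e))" if "e \<in> J" for e
    by metis
  note m = c(8-10) s u x a(3-6)
  obtain t where t: "t \<in> Mor C" "Dom C t = X" "Cod C t = fst F X"
    "\<And>e. e \<in> J \<Longrightarrow> Comp C t e = Comp C (snd F e) (\<sigma> (Dom C e))"
    by (rule coproduct_ex[OF X, of "fst F X" "\<lambda>e. Comp C (snd F e) (\<sigma> (Dom C e))"])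
      (simp_all add: m)
  \<comment> \<open>Towards the inverse of \<open>t\<close>: the morphisms
    \<open>Comp C e (u e)\<close> form a cocone over the image legs with vertex \<open>X\<close>.
    Its preimage under \<open>F\<close> consists of the \<open>k e\<close>, with vertex the preimage
    \<open>Z\<close> of \<open>X\<close>, and its mediating morphism \<open>v\<close> is then sent
    to \<open>w = snd F v\<close>.\<close>
  obtain Z where Z: "Z \<in> Obj C" "fst F Z = X" using oi(2) x(1) by (metis imageE)
  have "\<exists>k. k \<in> Mor C \<and> snd F k = Comp C e (u e)" if "e \<in> J" for e
  proof -
    have "Comp C e (u e) \<in> snd F ` Mor C" unfolding mi(2) using that by (simp add: m)
    then show ?thesis by force
  qed
  then obtain k where k: "k e \<in> Mor C" "snd F (k e) = Comp C e (u e)" if "e \<in> J" for e by metis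
  have kd: "Dom C (k e) = Dom C e" "Cod C (k e) = Z" if "e \<in> J" for e
  proof -
    have "fst F (Dom C (k e)) = fst F (Dom C e)" "fst F (Cod C (k e)) = fst F Z"
      using that k[OF that] Z a(5,6)[OF k(1)[OF that]] by (simp_all add: m)
    then show "Dom C (k e) = Dom C e" "Cod C (k e) = Z"
      using that k Z c(1,2) x(2) oi(1) by (metis inj_onD)+
  qed
  obtain v where v: "v \<in> Mor C" "Dom C v = X" "Cod C v = Z" "\<And>e. e \<in> J \<Longrightarrow> Comp C v e = k e"
    using k kd by (auto intro: coproduct_ex[OF X Z(1), of k])
  define w where "w = snd F v"
  have w: "w \<in> Mor C" "Dom C w = fst F X" "Cod C w = X" using v Z by (simp_all add: w_def a)
  have we: "Comp C w (snd F e) = Comp C e (u e)" if "e \<in> J" for e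
    unfolding w_def using that v k by (simp add: m flip: a(8))
  have wt: "Comp C w t = Ident C X"
  proof (rule coproduct_id[OF C X])
    fix e assume e: "e \<in> J"
    note me = e t(1-3) w m
    have "Comp C (Comp C w t) e = Comp C (Comp C w (snd F e)) (\<sigma> (Dom C e))"
      using t(4)[OF e] by (simp add: me flip: c(11))
    also have "\<dots> = e"
      unfolding we[OF e] using e by (simp add: me c(6) flip: c(11))
    finally show "Comp C (Comp C w t) e = e" .
  qed (simp_all add: t(1-3) w m)
  \<comment> \<open>The other composite is an endomorphism of \<open>fst F X\<close>; its preimage
    \<open>n\<close> fixes the legs of \<open>X\<close>, so it is an identity and so is its
    image.\<close>
  have "Comp C t w \<in> snd F ` Mor C" unfolding mi(2) using t(1-3) w by (simp add: m)
  then obtain n where n: "n \<in> Mor C" "snd F n = Comp C t w" by force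
  have nd: "Dom C n = X" "Cod C n = X"
  proof -
    have "fst F (Dom C n) = fst F X" "fst F (Cod C n) = fst F X"
      using n t(1-3) w by (simp_all add: m flip: a(5,6))
    then show "Dom C n = X" "Cod C n = X" using n x(1) c(1,2) oi(1) by (metis inj_onD)+
  qed
  have "n = Ident C X"
  proof (rule coproduct_id[OF C X n(1) nd])
    fix e assume e: "e \<in> J"
    note me = e t(1-3) w m n(1) nd
    have "snd F (Comp C n e) = Comp C t (Comp C w (snd F e))"
      using n(2) by (simp add: me a(8) flip: c(11))
    also have "\<dots> = Comp C (Comp C t e) (u e)"
      unfolding we[OF e] by (subst c(11)) (simp_all add: me)
    also have "\<dots> = snd F e"
      unfolding t(4)[OF e] by (simp add: me c(6) flip: c(11))
    finally show "Comp C n e = e"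
      using mi(1) n(1) nd e x(2,3) c(8) by (metis inj_onD)
  qed
  then have "Comp C t w = Ident C (fst F X)" using n(2) x(1) a(7) by simp
  then show ?thesis using that isosI[OF t(1-3) w] wt t(4) by blast
qed

section \<open>Splitting off an inner factor\<close>

text \<open>Conjugation by the isomorphisms \<open>t\<close> obtained from the coproducts is an
  inner automorphism \<open>Y\<close> that agrees with \<open>F\<close> on objects and on all legs,
  so the quotient \<open>inv Y\<close> times \<open>F\<close> fixes both.\<close>

lemma inner_times_cocone_fixing:
  assumes C: "is_category C" and F: "F \<in> automorphisms C"
    and J: "\<And>X. X \<in> Obj C \<Longrightarrow> coproduct C (J X) X"
    and id: "\<And>X e. X \<in> Obj C \<Longrightarrow> e \<in> J X \<Longrightarrow> Ident C (Dom C e) \<in> J (Dom C e)"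
    and iso: "\<And>X e. X \<in> Obj C \<Longrightarrow> e \<in> J X \<Longrightarrow> isomorphic C (fst F (Dom C e)) (Dom C e)"
  obtains Y \<Psi> where "Y \<in> inner_automorphisms C" "\<Psi> \<in> automorphisms C"
    "F = Y \<otimes>\<^bsub>aut_group C\<^esub> \<Psi>" "\<And>X. X \<in> Obj C \<Longrightarrow> fst \<Psi> X = X"
    "\<And>X e. X \<in> Obj C \<Longrightarrow> e \<in> J X \<Longrightarrow> snd \<Psi> e = e"
proof -
  note c = is_categoryD[OF C] and a = automorphismsD[OF F]
  \<comment> \<open>One isomorphism per object, chosen before any coproduct is considered, so that
    all legs with a common domain use the same one.\<close>
  define \<sigma> where "\<sigma> A = (SOME s. s \<in> isos C A (fst F A))" for A
  have \<sigma>: "\<sigma> (Dom C e) \<in> isos C (Dom C e) (fst F (Dom C e))" if "X \<in> Obj C" "e \<in> J X" for X e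
  proof -
    have "\<exists>s. s \<in> isos C (Dom C e) (fst F (Dom C e))"
      using iso[OF that] unfolding isomorphic_def isos_def by blast
    then show ?thesis unfolding \<sigma>_def by (rule someI_ex)
  qed
  have "\<exists>t. t \<in> isos C X (fst F X) \<and> (\<forall>e\<in>J X. Comp C t e = Comp C (snd F e) (\<sigma> (Dom C e)))"
    if "X \<in> Obj C" for X
    using coproduct_automorphism_iso[OF C F J[OF that] \<sigma>[OF that]] by metis
  then obtain t where "\<forall>X\<in>Obj C. t X \<in> isos C X (fst F X) \<and>
      (\<forall>e\<in>J X. Comp C (t X) e = Comp C (snd F e) (\<sigma> (Dom C e)))"
    by metis
  then have t: "t X \<in> isos C X (fst F X)"
    and te: "\<And>e. e \<in> J X \<Longrightarrow> Comp C (t X) e = Comp C (snd F e) (\<sigma> (Dom C e))"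
    if "X \<in> Obj C" for X
    using that by blast+
  obtain Y where Y: "Y \<in> inner_automorphisms C" "fst Y = fst F"
    "\<And>f. f \<in> Mor C \<Longrightarrow> Comp C (snd Y f) (t (Dom C f)) = Comp C (t (Cod C f)) f"
    using conjugation_inner_automorphism[OF C F t] by blast
  have Ya: "Y \<in> automorphisms C" using Y(1) by (simp add: inner_automorphisms_iff)
  note y = automorphismsD[OF Ya]
  have YF: "snd Y e = snd F e" if X: "X \<in> Obj C" and e: "e \<in> J X" for X e
  proof -
    let ?A = "Dom C e"
    have em: "e \<in> Mor C" "Cod C e = X" using coproductD[OF J[OF X]] e by auto
    have A: "?A \<in> Obj C" using c(1) em by blast
    \<comment> \<open>This is the purpose of \<open>id\<close>: the equation for \<open>t ?A\<close>
      at the leg \<open>Ident C ?A\<close> forces \<open>t\<close> to be the chosen isomorphism on a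
      summand. Hence \<open>snd Y e\<close> and \<open>snd F e\<close> agree after composition with
      the same isomorphism \<open>t ?A\<close>.\<close>
    have tA: "t ?A = \<sigma> ?A"
    proof -
      have m: "t ?A \<in> Mor C" "Dom C (t ?A) = ?A" using t[OF A] by (auto simp: isos_def)
      have n: "\<sigma> ?A \<in> Mor C" "Cod C (\<sigma> ?A) = fst F ?A" using \<sigma>[OF X e] by (auto simp: isos_def)
      show ?thesis using te[OF A id[OF X e]] A m n by (simp add: c a)
    qed
    have "Comp C (snd Y e) (t ?A) = Comp C (snd F e) (t ?A)"
      using Y(3)[OF em(1)] te[OF X e] em tA by simp
    then show ?thesis
      using isos_cancel_right[OF C t[OF A]] em y(4,5) a(4,5) Y(2) by metis
  qed
  let ?A = "aut_group C"
  interpret group ?A by (rule group_aut_group[OF C])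
  define \<Psi> where "\<Psi> = inv\<^bsub>?A\<^esub> Y \<otimes>\<^bsub>?A\<^esub> F"
  have car: "Y \<in> carrier ?A" "F \<in> carrier ?A" using Ya F by (simp_all add: aut_group_simps)
  have \<Psi>: "\<Psi> \<in> automorphisms C" using car by (simp add: \<Psi>_def flip: aut_group_simps(1))
  note p = automorphismsD[OF \<Psi>]
  have eq: "F = Y \<otimes>\<^bsub>?A\<^esub> \<Psi>" using car by (simp add: \<Psi>_def m_assoc[symmetric])
  have inj: "inj_on (fst Y) (Obj C)" "inj_on (snd Y) (Mor C)"
    using y(1,2) by (auto simp: Bij_def bij_betw_def)
  have "fst Y (fst \<Psi> X) = fst Y X" if "X \<in> Obj C" for X
    unfolding Y(2) using that Y(2) by (subst (2) eq) (simp add: aut_group_simps compose_eq)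
  then have "fst \<Psi> X = X" if "X \<in> Obj C" for X using that p(3) inj(1) by (metis inj_onD)
  moreover have "snd Y (snd \<Psi> f) = snd F f" if "f \<in> Mor C" for f
    using that by (subst eq) (simp add: aut_group_simps compose_eq)
  then have "snd \<Psi> e = e" if "X \<in> Obj C" "e \<in> J X" for X e
    using YF[OF that] coproductD(2)[OF J] that p(4) inj(2) by (metis inj_onD)
  ultimately show ?thesis using that Y(1) \<Psi> eq by blast
qed

section \<open>Elements of free algebras as morphisms from one-letter algebras\<close>

context
  fixes S :: "('s, 'f) signature"
    and \<eta> :: "'v \<Rightarrow> 's" and E :: "(('v, 'f) trm \<times> ('v, 'f) trm) set"
    and \<xi> :: "'x \<Rightarrow> 's" and X0 :: "'x set" and b :: "'s \<Rightarrow> 'x"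
  assumes sig: "signature S" and idn: "\<forall>e\<in>E. is_identity S \<eta> e" and X0: "\<xi> ` X0 \<subseteq> Sorts S"
    and b: "\<And>i. i \<in> Sorts S \<Longrightarrow> b i \<in> X0 \<and> \<xi> (b i) = i"
begin

private abbreviation (input) "C \<equiv> free_category S \<eta> E \<xi> X0"
private abbreviation (input) "F \<equiv> free_algebra S \<eta> E \<xi>"
private abbreviation (input) "U X \<equiv> univ (free_algebra S \<eta> E \<xi> X)"
private abbreviation (input) "srt X \<equiv> sort_of (free_algebra S \<eta> E \<xi> X)"
private abbreviation (input) "g \<equiv> gen S \<eta> E \<xi>"

private lemma Obj_iff: "X \<in> Obj C \<longleftrightarrow> finite X \<and> X \<subseteq> X0 \<and> inj_on (g X) X"
  using free_objects_iff[OF sig idn X0] by (simp add: free_category_def Let_def)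

private lemma Mor_iff:
  "(X, \<mu>, Y) \<in> Mor C \<longleftrightarrow> X \<in> Obj C \<and> Y \<in> Obj C \<and> \<mu> \<in> homs S (F X) (F Y)"
  by (simp add: free_category_def Let_def)

private lemma category_simps:
  "Dom C (X, \<mu>, Y) = X" "Cod C (X, \<mu>, Y) = Y"
  "Ident C X = (X, \<lambda>a\<in>U X. a, X)"
  "Comp C (Y, \<nu>, Z) (X, \<mu>, Y') = (X, compose (U X) \<nu> \<mu>, Z)"
  by (simp_all add: free_category_def Let_def)

text \<open>The uniqueness half of freeness, for morphisms of the category; \<open>Mor_ex\<close> is
  the existence half.\<close>

private lemma Mor_eqI:
  assumes "(X, \<mu>, Y) \<in> Mor C" "(X, \<nu>, Y) \<in> Mor C" "\<And>x. x \<in> X \<Longrightarrow> \<mu> (g X x) = \<nu> (g X x)"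
  shows "\<mu> = \<nu>"
proof -
  have X: "\<xi> ` X \<subseteq> Sorts S" and Y: "\<xi> ` Y \<subseteq> Sorts S"
    using assms(1) X0 by (auto simp: Mor_iff Obj_iff)
  have m: "\<mu> \<in> homs S (F X) (F Y)" "\<nu> \<in> homs S (F X) (F Y)" using assms by (simp_all add: Mor_iff)
  then have "\<forall>x\<in>X. \<mu> (g X x) \<in> U Y \<and> srt Y (\<mu> (g X x)) = \<xi> x"
    using gen_in[OF sig idn X] sort_gen[OF sig idn X] by (auto simp: homs_def)
  from free_algebra_universal[OF sig idn X free_algebra_in_variety[OF sig idn Y] this]
  show ?thesis using m assms(3) by metis
qed

private lemma Mor_ex:
  assumes "X \<in> Obj C" "Y \<in> Obj C" "\<And>x. x \<in> X \<Longrightarrow> h x \<in> U Y \<and> srt Y (h x) = \<xi> x"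
  obtains \<mu> where "(X, \<mu>, Y) \<in> Mor C" "\<And>x. x \<in> X \<Longrightarrow> \<mu> (g X x) = h x"
proof -
  have X: "\<xi> ` X \<subseteq> Sorts S" and Y: "\<xi> ` Y \<subseteq> Sorts S"
    using assms(1,2) X0 by (auto simp: Obj_iff)
  from free_algebra_universal[OF sig idn X free_algebra_in_variety[OF sig idn Y], of h]
  show ?thesis using that assms by (auto simp: Mor_iff)
qed

private lemma Mor_apply:
  assumes "(X, \<mu>, Y) \<in> Mor C" "a \<in> U X"
  shows "\<mu> a \<in> U Y" "srt Y (\<mu> a) = srt X a"
  using assms by (auto simp: Mor_iff homs_def)

private lemma generators:
  assumes "X \<in> Obj C" "x \<in> X"
  shows "g X x \<in> U X" "srt X (g X x) = \<xi> x" "\<xi> x \<in> Sorts S"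
proof -
  have X: "\<xi> ` X \<subseteq> Sorts S" using assms(1) X0 by (auto simp: Obj_iff)
  show "g X x \<in> U X" by (rule gen_in[OF sig idn X assms(2)])
  show "srt X (g X x) = \<xi> x" by (rule sort_gen[OF sig idn X assms(2)])
  show "\<xi> x \<in> Sorts S" using X assms(2) by blast
qed

private lemma srt_in:
  assumes "X \<in> Obj C" "a \<in> U X"
  shows "srt X a \<in> Sorts S"
proof -
  have "\<xi> ` X \<subseteq> Sorts S" using assms(1) X0 by (auto simp: Obj_iff)
  from free_algebra_in_variety[OF sig idn this] show ?thesis
    using assms(2) by (auto simp: variety_def is_algebra_def)
qed

text \<open>Injectivity of \<open>gen\<close> is trivial on a singleton, so the one-letter algebras
  are objects even if the identities collapse letters.\<close>

private lemma base:
  assumes "i \<in> Sorts S"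
  shows "{b i} \<in> Obj C" "g {b i} (b i) \<in> U {b i}" "srt {b i} (g {b i} (b i)) = i"
proof -
  show 1: "{b i} \<in> Obj C" using b[OF assms] by (simp add: Obj_iff)
  show "g {b i} (b i) \<in> U {b i}" "srt {b i} (g {b i} (b i)) = i"
    using generators[OF 1] b[OF assms] by auto
qed

text \<open>The morphism that represents the element \<open>a\<close>, with domain fixed by the sort
  of \<open>a\<close>. Freeness on one letter makes the choice unique, see
  \<open>elem_hom_eq\<close>.\<close>

definition elem_hom :: "'x set \<Rightarrow> ('x, 'f) trm set \<Rightarrow> ('x, 'f) trm set \<Rightarrow> ('x, 'f) trm set" where
  "elem_hom X a = (SOME \<mu>. ({b (srt X a)}, \<mu>, X) \<in> Mor C \<and> \<mu> (g {b (srt X a)} (b (srt X a))) = a)"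

private lemma elem_hom:
  assumes X: "X \<in> Obj C" and a: "a \<in> U X"
  shows "({b (srt X a)}, elem_hom X a, X) \<in> Mor C" "elem_hom X a (g {b (srt X a)} (b (srt X a))) = a"
proof -
  let ?i = "srt X a"
  have i: "?i \<in> Sorts S" by (rule srt_in[OF X a])
  obtain \<mu> where "({b ?i}, \<mu>, X) \<in> Mor C" "\<And>x. x \<in> {b ?i} \<Longrightarrow> \<mu> (g {b ?i} x) = a"
    by (rule Mor_ex[OF base(1)[OF i] X, of "\<lambda>_. a"]) (use a b[OF i] in auto)
  then have "\<exists>\<mu>. ({b ?i}, \<mu>, X) \<in> Mor C \<and> \<mu> (g {b ?i} (b ?i)) = a" by auto
  from someI_ex[OF this]
  show "({b ?i}, elem_hom X a, X) \<in> Mor C" "elem_hom X a (g {b ?i} (b ?i)) = a"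
    by (simp_all add: elem_hom_def)
qed

text \<open>A morphism from a one-letter algebra is determined by the image of the generator, so
  evaluation there inverts \<open>elem_hom\<close>.\<close>

private lemma elem_hom_eq:
  assumes i: "i \<in> Sorts S" and \<mu>: "({b i}, \<mu>, X) \<in> Mor C" and a: "\<mu> (g {b i} (b i)) = a"
  shows "a \<in> U X" "srt X a = i" "\<mu> = elem_hom X a"
proof -
  have X: "X \<in> Obj C" using \<mu> by (simp add: Mor_iff)
  show 1: "a \<in> U X" "srt X a = i" using Mor_apply[OF \<mu> base(2)[OF i]] base(3)[OF i] a by auto
  show "\<mu> = elem_hom X a" using elem_hom[OF X 1(1)] \<mu> a 1(2) by (intro Mor_eqI) auto
qed

section \<open>Free algebras as coproducts of one-letter algebras\<close>

text \<open>The leg of a letter \<open>x\<close> starts at the fixed letter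
  \<open>b (\<xi> x)\<close> of its sort instead of \<open>x\<close> itself, so every leg has a
  domain of the form \<open>{b i}\<close>.\<close>

definition cocone where
  "cocone X = (\<lambda>x. ({b (\<xi> x)}, elem_hom X (g X x), X)) ` X"

text \<open>A competing cocone picks one element of \<open>F(Y)\<close> of the right sort for each
  letter of \<open>X\<close>, and mediating means extending this map \<open>h\<close> to a
  homomorphism; this is freeness of \<open>F(X)\<close>.\<close>

private lemma coproduct_cocone:
  assumes X: "X \<in> Obj C"
  shows "coproduct C (cocone X) X"
proof -
  have x: "({b (\<xi> x)}, elem_hom X (g X x), X) \<in> Mor C"
    "elem_hom X (g X x) (g {b (\<xi> x)} (b (\<xi> x))) = g X x" if "x \<in> X" for x
    using elem_hom[OF X generators(1)[OF X that]] generators(2)[OF X that] by auto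
  have ex1: "\<exists>!m. m \<in> Mor C \<and> Dom C m = X \<and> Cod C m = Y \<and> (\<forall>e\<in>cocone X. Comp C m e = k e)"
    if Y: "Y \<in> Obj C"
      and k: "\<forall>e\<in>cocone X. k e \<in> Mor C \<and> Dom C (k e) = Dom C e \<and> Cod C (k e) = Y" for Y k
  proof -
    define e where "e x = ({b (\<xi> x)}, elem_hom X (g X x), X)" for x
    have "\<exists>\<kappa>. k (e x) = ({b (\<xi> x)}, \<kappa>, Y) \<and> ({b (\<xi> x)}, \<kappa>, Y) \<in> Mor C" if "x \<in> X" for x
    proof -
      have "e x \<in> cocone X" using that by (simp add: cocone_def e_def)
      then have "k (e x) \<in> Mor C" "Dom C (k (e x)) = {b (\<xi> x)}" "Cod C (k (e x)) = Y"
        using k by (auto simp: e_def category_simps)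
      then show ?thesis by (cases "k (e x)") (auto simp: category_simps)
    qed
    then obtain \<kappa> where \<kappa>: "k (e x) = ({b (\<xi> x)}, \<kappa> x, Y)" "({b (\<xi> x)}, \<kappa> x, Y) \<in> Mor C"
      if "x \<in> X" for x
      by metis
    define h where "h x = \<kappa> x (g {b (\<xi> x)} (b (\<xi> x)))" for x
    have h: "h x \<in> U Y" "srt Y (h x) = \<xi> x" "\<kappa> x = elem_hom Y (h x)" if "x \<in> X" for x
      using elem_hom_eq[OF generators(3)[OF X that] \<kappa>(2)[OF that]] by (simp_all add: h_def)
    \<comment> \<open>Composites with legs are morphisms from one-letter algebras, so they may be
      compared at the generator. What remains is a condition on the generators of
      \<open>F(X)\<close>, met by \<open>Mor_ex\<close> and determined by
      \<open>Mor_eqI\<close>.\<close>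
    have iff: "(\<forall>e\<in>cocone X. Comp C (X, \<mu>, Y) e = k e) \<longleftrightarrow> (\<forall>x\<in>X. \<mu> (g X x) = h x)"
      if m: "(X, \<mu>, Y) \<in> Mor C" for \<mu>
    proof -
      have "Comp C (X, \<mu>, Y) (e x) = k (e x) \<longleftrightarrow> \<mu> (g X x) = h x" if "x \<in> X" for x
      proof -
        let ?i = "\<xi> x"
        let ?c = "compose (U {b ?i}) \<mu> (elem_hom X (g X x))"
        have i: "?i \<in> Sorts S" by (rule generators(3)[OF X that])
        have "Comp C (X, \<mu>, Y) (e x) \<in> Mor C"
          using m x(1)[OF that]
          by (intro is_categoryD(8)[OF is_category_free_category]) (simp_all add: e_def category_simps)
        then have c: "({b ?i}, ?c, Y) \<in> Mor C" by (simp add: e_def category_simps)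
        have ca: "?c (g {b ?i} (b ?i)) = \<mu> (g X x)"
          using base(2)[OF i] x(2)[OF that] by (simp add: compose_eq)
        have "?c = \<kappa> x \<longleftrightarrow> \<mu> (g X x) = h x"
        proof
          assume "?c = \<kappa> x"
          then have "?c (g {b ?i} (b ?i)) = h x" by (simp only: h_def)
          then show "\<mu> (g X x) = h x" by (simp only: ca)
        next
          assume "\<mu> (g X x) = h x"
          then show "?c = \<kappa> x" by (simp only: elem_hom_eq(3)[OF i c ca] h(3)[OF that])
        qed
        then show ?thesis using \<kappa>(1)[OF that] by (simp add: e_def category_simps)
      qed
      then show ?thesis by (simp add: cocone_def e_def)
    qed
    obtain \<mu> where \<mu>: "(X, \<mu>, Y) \<in> Mor C" "\<And>x. x \<in> X \<Longrightarrow> \<mu> (g X x) = h x"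
      using Mor_ex[OF X Y, of h] h by blast
    show ?thesis
    proof (rule ex1I[of _ "(X, \<mu>, Y)"])
      show "(X, \<mu>, Y) \<in> Mor C \<and> Dom C (X, \<mu>, Y) = X \<and> Cod C (X, \<mu>, Y) = Y \<and>
          (\<forall>e\<in>cocone X. Comp C (X, \<mu>, Y) e = k e)"
        using iff \<mu> by (simp add: category_simps)
    next
      fix m assume m: "m \<in> Mor C \<and> Dom C m = X \<and> Cod C m = Y \<and> (\<forall>e\<in>cocone X. Comp C m e = k e)"
      then obtain \<nu> where \<nu>: "m = (X, \<nu>, Y)" by (cases m) (auto simp: category_simps)
      have \<nu>m: "(X, \<nu>, Y) \<in> Mor C" using m by (simp only: \<nu>)
      have "\<forall>x\<in>X. \<nu> (g X x) = h x" using m unfolding iff[OF \<nu>m, symmetric] by (simp add: \<nu>)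
      then have "\<nu> = \<mu>" using \<mu>(2) by (intro Mor_eqI[OF \<nu>m \<mu>(1)]) simp
      then show "m = (X, \<mu>, Y)" by (simp add: \<nu>)
    qed
  qed
  show ?thesis
    unfolding coproduct_def
  proof (intro conjI allI ballI impI)
    show "X \<in> Obj C" by (rule X)
    show "cocone X \<subseteq> Mor C" using x(1) by (auto simp: cocone_def)
    show "Cod C e = X" if "e \<in> cocone X" for e using that by (auto simp: cocone_def category_simps)
  qed (rule ex1)
qed

text \<open>The identity sends the generator to itself, so it is the leg of the letter
  \<open>b i\<close>, whose sort is \<open>i\<close>. This supplies the condition \<open>id\<close>
  of \<open>inner_times_cocone_fixing\<close>.\<close>

private lemma Ident_in_cocone:
  assumes i: "i \<in> Sorts S"
  shows "Ident C {b i} \<in> cocone {b i}"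
proof -
  have "Ident C {b i} \<in> Mor C"
    by (rule is_categoryD(3)[OF is_category_free_category base(1)[OF i]])
  then have "(\<lambda>a\<in>U {b i}. a) = elem_hom {b i} (g {b i} (b i))"
    using elem_hom_eq(3)[OF i, of "\<lambda>a\<in>U {b i}. a" "{b i}"] base(2)[OF i] by (simp add: category_simps)
  then show ?thesis using b[OF i] by (simp add: cocone_def category_simps)
qed

section \<open>Strong stability from the action on elements\<close>

text \<open>Since \<Psi> permutes the morphisms from each \<open>{b i}\<close> to \<open>X\<close>,
  it permutes the elements of \<open>F(X)\<close> of each sort. The letters stay fixed because their
  morphisms are the legs, and functoriality of \<Psi> becomes the conjugation formula.\<close>

private lemma cocone_fixing_strongly_stable:
  assumes \<Psi>: "\<Psi> \<in> automorphisms C" and o: "\<And>X. X \<in> Obj C \<Longrightarrow> fst \<Psi> X = X"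
    and e: "\<And>X e. X \<in> Obj C \<Longrightarrow> e \<in> cocone X \<Longrightarrow> snd \<Psi> e = e"
  shows "\<Psi> \<in> strongly_stable_automorphisms S \<eta> E \<xi> X0"
proof -
  note a = automorphismsD[OF \<Psi>]
  have mi: "inj_on (snd \<Psi>) (Mor C)" "snd \<Psi> ` Mor C = Mor C"
    using a(2) by (auto simp: Bij_def bij_betw_def)
  \<comment> \<open>As objects are fixed, \<Psi> changes only the middle component of a
    triple.\<close>
  define p where "p X \<mu> Y = fst (snd (snd \<Psi> (X, \<mu>, Y)))" for X \<mu> Y
  have p: "snd \<Psi> (X, \<mu>, Y) = (X, p X \<mu> Y, Y)" "(X, p X \<mu> Y, Y) \<in> Mor C"
    if m: "(X, \<mu>, Y) \<in> Mor C" for X \<mu> Y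
  proof -
    have "X \<in> Obj C" "Y \<in> Obj C" using m by (simp_all add: Mor_iff)
    then show 1: "snd \<Psi> (X, \<mu>, Y) = (X, p X \<mu> Y, Y)"
      using a(5,6)[OF m] o by (cases "snd \<Psi> (X, \<mu>, Y)") (simp add: p_def category_simps)
    show "(X, p X \<mu> Y, Y) \<in> Mor C" using a(4)[OF m] unfolding 1 .
  qed
  \<comment> \<open>\<open>s X a\<close> is the element represented by the image under \<Psi> of the
    morphism that represents \<open>a\<close>.\<close>
  define s where "s X a = p {b (srt X a)} (elem_hom X a) X (g {b (srt X a)} (b (srt X a)))" for X a
  have s: "s X a \<in> U X" "srt X (s X a) = srt X a" "p {b (srt X a)} (elem_hom X a) X = elem_hom X (s X a)"
    if X: "X \<in> Obj C" and au: "a \<in> U X" for X a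
    by (rule elem_hom_eq[OF srt_in[OF X au] p(2)[OF elem_hom(1)[OF X au]] s_def[symmetric]])+
  have inj: "inj_on (s X) (U X)" if X: "X \<in> Obj C" for X
  proof (rule inj_onI)
    fix a a' assume aa: "a \<in> U X" "a' \<in> U X" "s X a = s X a'"
    then have i: "srt X a = srt X a'" using s(2)[OF X] by metis
    have "snd \<Psi> ({b (srt X a)}, elem_hom X a, X) = snd \<Psi> ({b (srt X a')}, elem_hom X a', X)"
      using p(1)[OF elem_hom(1)[OF X aa(1)]] p(1)[OF elem_hom(1)[OF X aa(2)]] s(3)[OF X] aa i by metis
    from inj_onD[OF mi(1) this elem_hom(1)[OF X aa(1)] elem_hom(1)[OF X aa(2)]]
    have "elem_hom X a = elem_hom X a'" by simp
    then show "a = a'" using elem_hom(2)[OF X] aa(1,2) i by metis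
  qed
  have surj: "\<exists>a\<in>U X. s X a = d" if X: "X \<in> Obj C" and d: "d \<in> U X" for X d
  proof -
    let ?i = "srt X d"
    have i: "?i \<in> Sorts S" by (rule srt_in[OF X d])
    \<comment> \<open>A preimage under \<Psi> of the morphism representing \<open>d\<close> again
      goes from \<open>{b ?i}\<close> to \<open>X\<close>; its value at the generator is the wanted
      preimage of \<open>d\<close>.\<close>
    have "({b ?i}, elem_hom X d, X) \<in> snd \<Psi> ` Mor C" unfolding mi(2) by (rule elem_hom(1)[OF X d])
    then obtain m where m: "m \<in> Mor C" "snd \<Psi> m = ({b ?i}, elem_hom X d, X)" by fastforce
    obtain A f B where "m = (A, f, B)" by (cases m)
    then have f: "(A, f, B) \<in> Mor C" "snd \<Psi> (A, f, B) = ({b ?i}, elem_hom X d, X)"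
      using m by simp_all
    then have AB: "A = {b ?i}" "B = X" and pf: "p {b ?i} f X = elem_hom X d" using p(1)[OF f(1)] by auto
    let ?a = "f (g {b ?i} (b ?i))"
    note q = elem_hom_eq[OF i f(1)[unfolded AB] HOL.refl]
    have "s X ?a = p {b ?i} f X (g {b ?i} (b ?i))" by (simp only: s_def q(2) q(3)[symmetric])
    then have "s X ?a = d" by (simp only: pf elem_hom(2)[OF X d])
    then show ?thesis using q(1) by blast
  qed
  have bij: "bij_betw (s X) (U X) (U X)" if "X \<in> Obj C" for X
    using inj surj s(1) that by (fastforce simp: bij_betw_def)
  have fix_gen: "s X (g X x) = g X x" if X: "X \<in> Obj C" and x: "x \<in> X" for X x
  proof -
    note gx = generators[OF X x]
    have "({b (\<xi> x)}, elem_hom X (g X x), X) \<in> cocone X" using x by (simp add: cocone_def)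
    from e[OF X this] have "p {b (\<xi> x)} (elem_hom X (g X x)) X = elem_hom X (g X x)"
      using p(1)[OF elem_hom(1)[OF X gx(1)]] gx(2) by simp
    then show ?thesis using elem_hom(2)[OF X gx(1)] gx(2) by (simp add: s_def)
  qed
  \<comment> \<open>The composite of \<mu> with the morphism representing \<open>d\<close>
    represents \<open>\<mu> d\<close>. Applying \<Psi> to this composite and evaluating at the
    generator gives the equation.\<close>
  have nat: "p X \<mu> Y (s X d) = s Y (\<mu> d)" if m: "(X, \<mu>, Y) \<in> Mor C" and d: "d \<in> U X" for X \<mu> Y d
  proof -
    let ?i = "srt X d"
    have X: "X \<in> Obj C" and Y: "Y \<in> Obj C" using m by (simp_all add: Mor_iff)
    have i: "?i \<in> Sorts S" by (rule srt_in[OF X d])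
    note pd = elem_hom[OF X d]
    let ?c = "compose (U {b ?i}) \<mu> (elem_hom X d)"
    have eq: "Comp C (X, \<mu>, Y) ({b ?i}, elem_hom X d, X) = ({b ?i}, ?c, Y)" by (simp add: category_simps)
    have c: "({b ?i}, ?c, Y) \<in> Mor C"
      unfolding eq[symmetric] using m pd(1)
      by (intro is_categoryD(8)[OF is_category_free_category]) (simp_all add: category_simps)
    have ca: "?c (g {b ?i} (b ?i)) = \<mu> d" using base(2)[OF i] pd(2) by (simp add: compose_eq)
    note q = elem_hom_eq[OF i c ca]
    have "snd \<Psi> ({b ?i}, ?c, Y) = Comp C (snd \<Psi> (X, \<mu>, Y)) (snd \<Psi> ({b ?i}, elem_hom X d, X))"
      unfolding eq[symmetric] using a(8)[OF pd(1) m] by (simp add: category_simps)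
    then have "p {b ?i} ?c Y = compose (U {b ?i}) (p X \<mu> Y) (p {b ?i} (elem_hom X d) X)"
      unfolding p(1)[OF c] p(1)[OF m] p(1)[OF pd(1)] by (simp add: category_simps)
    then have "p {b ?i} (elem_hom Y (\<mu> d)) Y (g {b ?i} (b ?i)) = p X \<mu> Y (s X d)"
      using base(2)[OF i] q(3) by (simp add: compose_eq s_def)
    then show ?thesis using q(2) by (simp add: s_def)
  qed
  \<comment> \<open>The equation \<open>nat\<close>, read at the preimage of a point under the
    bijection \<open>s X\<close>.\<close>
  have cj: "snd \<Psi> (X, \<mu>, Y) = (X, \<lambda>a\<in>U X. s Y (\<mu> (inv_into (U X) (s X) a)), Y)"
    if m: "(X, \<mu>, Y) \<in> Mor C" for X \<mu> Y
  proof -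
    have X: "X \<in> Obj C" using m by (simp add: Mor_iff)
    have "p X \<mu> Y = (\<lambda>a\<in>U X. s Y (\<mu> (inv_into (U X) (s X) a)))"
    proof (rule extensionalityI[of _ "U X"])
      show "p X \<mu> Y \<in> extensional (U X)" using p(2)[OF m] by (auto simp: Mor_iff homs_def PiE_def)
      fix d assume d: "d \<in> U X"
      then have "d \<in> s X ` U X" using bij[OF X] by (simp add: bij_betw_def)
      then show "p X \<mu> Y d = (\<lambda>a\<in>U X. s Y (\<mu> (inv_into (U X) (s X) a))) d"
        using nat[OF m inv_into_into[of d "s X" "U X"]] d by (simp add: f_inv_into_f)
    qed simp
    then show ?thesis using p(1)[OF m] by simp
  qed
  obtain \<Psi>o \<Psi>m where \<Psi>_eq: "\<Psi> = (\<Psi>o, \<Psi>m)" by (cases \<Psi>)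
  show ?thesis
    unfolding strongly_stable_automorphisms_def Let_def \<Psi>_eq mem_Collect_eq prod.case
    by (intro conjI ballI allI impI exI[of _ s])
      (use \<Psi> o cj bij s(2) fix_gen in \<open>simp_all add: \<Psi>_eq\<close>)
qed

text \<open>All legs start at objects \<open>{b i}\<close>, so the assumption on one-letter algebras
  is the isomorphism condition of \<open>inner_times_cocone_fixing\<close>.\<close>

lemma inner_times_strongly_stable:
  assumes \<Phi>: "\<Phi> \<in> automorphisms C"
    and iso: "\<And>i. i \<in> Sorts S \<Longrightarrow> isomorphic C (fst \<Phi> {b i}) {b i}"
  shows "\<Phi> \<in> inner_automorphisms C <#>\<^bsub>aut_group C\<^esub> strongly_stable_automorphisms S \<eta> E \<xi> X0"
proof -
  have dom: "\<exists>i\<in>Sorts S. Dom C e = {b i}" if "X \<in> Obj C" "e \<in> cocone X" for X e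
    using that generators(3)[OF that(1)] by (auto simp: cocone_def category_simps)
  have id: "Ident C (Dom C e) \<in> cocone (Dom C e)"
    and iso': "isomorphic C (fst \<Phi> (Dom C e)) (Dom C e)" if "X \<in> Obj C" "e \<in> cocone X" for X e
    using dom[OF that] Ident_in_cocone iso by auto
  obtain Y \<Psi> where Y: "Y \<in> inner_automorphisms C" and \<Psi>: "\<Psi> \<in> automorphisms C"
    "\<And>X. X \<in> Obj C \<Longrightarrow> fst \<Psi> X = X" "\<And>X e. X \<in> Obj C \<Longrightarrow> e \<in> cocone X \<Longrightarrow> snd \<Psi> e = e"
    and eq: "\<Phi> = Y \<otimes>\<^bsub>aut_group C\<^esub> \<Psi>"
    by (rule inner_times_cocone_fixing[OF is_category_free_category \<Phi> coproduct_cocone id iso'];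
        (assumption | (rule that; blast)))
  have "\<Psi> \<in> strongly_stable_automorphisms S \<eta> E \<xi> X0"
    by (rule cocone_fixing_strongly_stable[OF \<Psi>])
  then show ?thesis unfolding eq set_mult_def using Y by blast
qed

end

section \<open>Exchanging the factors, and the theorem\<close>

text \<open>Inversion reverses products and preserves subgroups: a factorization of
  \<open>inv x\<close> in one order inverts to one of \<open>x\<close> in the other.\<close>

lemma (in group) subgroup_set_mult_commute:
  assumes H: "subgroup H G" and K: "subgroup K G" and eq: "carrier G = H <#> K"
  shows "carrier G = K <#> H"
proof
  show "K <#> H \<subseteq> carrier G" using H K by (simp add: set_mult_closed subgroup.subset)
  show "carrier G \<subseteq> K <#> H"
  proof
    fix x assume x: "x \<in> carrier G"
    then have "inv x \<in> H <#> K" by (simp flip: eq)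
    then obtain h k where hk: "h \<in> H" "k \<in> K" "inv x = h \<otimes> k" by (auto simp: set_mult_def)
    then have "x = inv (h \<otimes> k)" using x by (simp flip: hk(3))
    also have "\<dots> = inv k \<otimes> inv h"
      using hk H K by (simp add: inv_mult_group subgroup.mem_carrier)
    finally show "x \<in> K <#> H"
      using hk H K by (auto simp: set_mult_def intro: subgroup.m_inv_closed)
  qed
qed

theorem theorem2p3:
  fixes S :: "('s, 'f) signature"
    and \<eta> :: "'v \<Rightarrow> 's" and E :: "(('v, 'f) trm \<times> ('v, 'f) trm) set"
    and \<xi> :: "'x \<Rightarrow> 's" and X0 :: "'x set"
  defines "\<Theta>0 \<equiv> free_category S \<eta> E \<xi> X0"
  defines "\<AA> \<equiv> aut_group \<Theta>0"
    and "\<YY> \<equiv> inner_automorphisms \<Theta>0"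
    and "\<SS> \<equiv> strongly_stable_automorphisms S \<eta> E \<xi> X0"
  assumes "signature S"
    and "\<forall>e\<in>E. is_identity S \<eta> e"
    and "\<xi> ` X0 \<subseteq> Sorts S"
    and "\<forall>i\<in>Sorts S. countable {x\<in>X0. \<xi> x = i} \<and> infinite {x\<in>X0. \<xi> x = i}"
    and "\<forall>(\<Phi>o, \<Phi>m)\<in>automorphisms \<Theta>0. \<forall>i\<in>Sorts S. \<forall>x\<in>X0. \<xi> x = i \<longrightarrow>
           isomorphic \<Theta>0 (\<Phi>o {x}) {x}"
  shows "carrier \<AA> = \<YY> <#>\<^bsub>\<AA>\<^esub> \<SS> \<and> carrier \<AA> = \<SS> <#>\<^bsub>\<AA>\<^esub> \<YY>"
proof -
  have C: "is_category \<Theta>0" unfolding \<Theta>0_def by (rule is_category_free_category)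
  interpret group \<AA> unfolding \<AA>_def by (rule group_aut_group[OF C])
  have Y: "subgroup \<YY> \<AA>" unfolding \<YY>_def \<AA>_def by (rule subgroup_inner_automorphisms[OF C])
  have St: "subgroup \<SS> \<AA>"
    unfolding \<SS>_def \<AA>_def \<Theta>0_def by (rule subgroup_strongly_stable_automorphisms)
  \<comment> \<open>An infinite set of letters of each sort is nonempty, which allows the choice of
    \<open>b\<close>.\<close>
  have "\<exists>x. x \<in> X0 \<and> \<xi> x = i" if "i \<in> Sorts S" for i
    using assms(8) that by (metis (mono_tags, lifting) Collect_empty_eq finite.emptyI)
  then obtain b where b: "\<And>i. i \<in> Sorts S \<Longrightarrow> b i \<in> X0 \<and> \<xi> (b i) = i" by metis
  have "isomorphic \<Theta>0 (fst \<Phi> {b i}) {b i}" if "\<Phi> \<in> automorphisms \<Theta>0" "i \<in> Sorts S" for \<Phi> i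
    using bspec[OF assms(9) that(1)] that(2) b[OF that(2)] by (simp add: split_beta)
  then have "automorphisms \<Theta>0 \<subseteq> \<YY> <#>\<^bsub>\<AA>\<^esub> \<SS>"
    using inner_times_strongly_stable[OF assms(5-7) b] by (auto simp: \<YY>_def \<AA>_def \<SS>_def \<Theta>0_def)
  then have "carrier \<AA> = \<YY> <#>\<^bsub>\<AA>\<^esub> \<SS>"
    using set_mult_closed[OF subgroup.subset[OF Y] subgroup.subset[OF St]]
    by (auto simp: \<AA>_def aut_group_simps(1))
  then show ?thesis using subgroup_set_mult_commute[OF Y St] by blast
qed

end
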